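(* Let $k\ge \ell\ge 1$ be integers, let $\mathsf{X}=\mathbb{R}^k$ with Borel algebra $\mathcal{A}$, and let $\pi$ be a probability measure on $\mathsf{X}$ with a density $\dot\pi$ with respect to Lebesgue measure. Let $\mathsf{W}=\{(w_1,\dots,w_\ell)\in(\mathbb{R}^k)^\ell:\ w_i^\top w_i=1 \text{ for each } i,\ w_i^\top w_j=0 \text{ if } i\ne j\}$ and let $\nu$ be a Borel probability measure on $\mathsf{W}$. For $x\in\mathsf{X}$, $w\in\mathsf{W}$ let $\theta(x,w)=x-\sum_{i=1}^\ell (w_i^\top x)w_i$, and let $\varphi_{w,\theta(x,w)}$ be the probability measure on $\mathbb{R}^\ell$ given by $$\varphi_{w,\theta(x,w)}(\mathrm{d}u)=\frac{\dot\pi(\theta(x,w)+\sum_{i=1}^\ell u_iw_i)\,\mathrm{d}u}{\int_{\mathbb{R}^\ell}\dot\pi(\theta(x,w)+\sum_{i=1}^\ell u_i'w_i)\,\mathrm{d}u'},$$ whenever the denominator is in $(0,\infty)$ (which, for each $w$, holds for $\pi$-a.e. $x$). Let $H_{w,\theta(x,w)}$ be a Markov transition kernel on $\mathbb{R}^\ell$ that is reversible with respect to $\varphi_{w,\theta(x,w)}$, such that $(x,w,u)\mapsto H_{w,\theta(x,w)}(u,\mathsf{B})$ is measurable for every measurable $\mathsf{B}\subset\mathbb{R}^\ell$. Define the Markov transition kernels on $\mathsf{X}$ $$\bar S(x,\mathsf{A})=\int_{\mathsf{W}}\nu(\mathrm{d}w)\int_{\mathbb{R}^\ell}\varphi_{w,\theta(x,w)}(\mathrm{d}u)\,\mathbf{1}_{\mathsf{A}}\Big(\theta(x,w)+\sum_{i=1}^\ell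 u_iw_i\Big),$$ $$S(x,\mathsf{A})=\int_{\mathsf{W}}\nu(\mathrm{d}w)\int_{\mathbb{R}^\ell}H_{w,\theta(x,w)}\big((w_i^\top x)_{i=1}^\ell,\mathrm{d}u\big)\,\mathbf{1}_{\mathsf{A}}\Big(\theta(x,w)+\sum_{i=1}^\ell u_iw_i\Big).$$ Then $S$ and $\bar S$ are both reversible with respect to $\pi$, and, for every $f\in L_0^2(\pi)$, $$\mathcal{E}_S(f)\ge\Big[\operatorname*{ess\,inf}_{w,x}\mathrm{Gap}(H_{w,\theta(x,w)})\Big]\mathcal{E}_{\bar S}(f),\qquad \mathrm{Gap}(S)\ge\Big[\operatorname*{ess\,inf}_{w,x}\mathrm{Gap}(H_{w,\theta(x,w)})\Big]\mathrm{Gap}(\bar S),$$ where the essential infimum is taken with respect to $\nu\times\pi$.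
   Context: For a probability measure $\rho$, $L^2(\rho)$ is the real Hilbert space of square-integrable functions (modulo a.e. equality) with inner product $\langle f,g\rangle_\rho=\int fg\,\mathrm{d}\rho$ and norm $\|\cdot\|_\rho$, and $L_0^2(\rho)=\{f\in L^2(\rho):\int f\,\mathrm{d}\rho=0\}$. A Markov transition kernel $K$ with $\rho K=\rho$ acts on $L_0^2(\rho)$ by $Kf(w)=\int K(w,\mathrm{d}w')f(w')$; it is reversible with respect to $\rho$ iff this operator is self-adjoint. For a self-adjoint operator $J$ on $L_0^2(\rho)$ with operator norm at most $1$, the Dirichlet form is $\mathcal{E}_J(f)=\|f\|_\rho^2-\langle f,Jf\rangle_\rho$ and the right spectral gap is $\mathrm{Gap}(J)=\inf_{f\in L_0^2(\rho)\setminus\{0\}}\mathcal{E}_J(f)/\|f\|_\rho^2\in[0,2]$. The gap of $H_{w,\theta(x,w)}$ is computed in $L_0^2(\varphi_{w,\theta(x,w)})$; those of $S$ and $\bar S$ in $L_0^2(\pi)$. *)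

theory Defs
  imports "HOL-Probability.Probability"
begin

text \<open>
  Elements of the Hilbert space \<open>L\<^sup>2(\<rho>)\<close> are represented by square-integrable functions; equality in
  the space is equality almost everywhere, and all quantities below respect it.
\<close>

definition L2_zero :: "'a measure \<Rightarrow> ('a \<Rightarrow> real) set" where
  "L2_zero \<rho> = {f \<in> borel_measurable \<rho>. integrable \<rho> (\<lambda>x. (f x)\<^sup>2) \<and> (\<integral>x. f x \<partial>\<rho>) = 0}"

definition L2_inner :: "'a measure \<Rightarrow> ('a \<Rightarrow> real) \<Rightarrow> ('a \<Rightarrow> real) \<Rightarrow> real" where
  "L2_inner \<rho> f g = (\<integral>x. f x * g x \<partial>\<rho>)"

definition L2_norm :: "'a measure \<Rightarrow> ('a \<Rightarrow> real) \<Rightarrow> real" where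
  "L2_norm \<rho> f = sqrt (L2_inner \<rho> f f)"

definition self_adjoint_on_L2_zero :: "'a measure \<Rightarrow> (('a \<Rightarrow> real) \<Rightarrow> ('a \<Rightarrow> real)) \<Rightarrow> bool" where
  "self_adjoint_on_L2_zero \<rho> J \<longleftrightarrow>
     (\<forall>f\<in>L2_zero \<rho>. \<forall>g\<in>L2_zero \<rho>. L2_inner \<rho> f (J g) = L2_inner \<rho> (J f) g)"

definition dirichlet_form :: "'a measure \<Rightarrow> (('a \<Rightarrow> real) \<Rightarrow> ('a \<Rightarrow> real)) \<Rightarrow> ('a \<Rightarrow> real) \<Rightarrow> real" where
  "dirichlet_form \<rho> J f = (L2_norm \<rho> f)\<^sup>2 - L2_inner \<rho> f (J f)"

text \<open>
  The infimum is a real one; it is meaningful whenever \<open>L\<^sub>0\<^sup>2(\<rho>)\<close> is nontrivial and \<open>J\<close> has operator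
  norm at most 1.
\<close>

definition gap :: "'a measure \<Rightarrow> (('a \<Rightarrow> real) \<Rightarrow> ('a \<Rightarrow> real)) \<Rightarrow> real" where
  "gap \<rho> J = (INF f \<in> {f \<in> L2_zero \<rho>. \<not> (AE x in \<rho>. f x = 0)}.
                dirichlet_form \<rho> J f / (L2_norm \<rho> f)\<^sup>2)"

definition markov_kernel :: "'a measure \<Rightarrow> ('a \<Rightarrow> 'a measure) \<Rightarrow> bool" where
  "markov_kernel M K \<longleftrightarrow> K \<in> M \<rightarrow>\<^sub>M prob_algebra M"

definition kernel_op :: "('a \<Rightarrow> 'a measure) \<Rightarrow> ('a \<Rightarrow> real) \<Rightarrow> 'a \<Rightarrow> real" where
  "kernel_op K f x = (\<integral>y. f y \<partial>(K x))"

definition reversible :: "'a measure \<Rightarrow> ('a \<Rightarrow> 'a measure) \<Rightarrow> bool" where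
  "reversible \<rho> K \<longleftrightarrow>
     markov_kernel \<rho> K \<and> (\<rho> \<bind> K) = \<rho> \<and> self_adjoint_on_L2_zero \<rho> (kernel_op K)"

text \<open>
  Defined directly rather than as \<open>- esssup M (- f)\<close>, because \<open>esssup\<close> takes the value \<open>top\<close> on every
  function that is not Borel measurable.
\<close>

definition essinf :: "'a measure \<Rightarrow> ('a \<Rightarrow> real) \<Rightarrow> real" where
  "essinf M f = Sup {c. AE x in M. c \<le> f x}"

text \<open>
  The dimensions \<open>k\<close> and \<open>\<ell>\<close> are \<open>CARD('k)\<close> and \<open>CARD('l)\<close>; the \<open>i\<close>-th vector of a frame \<open>w\<close> is \<open>w $ i\<close>.
\<close>

definition frames :: "(real ^ 'k ^ 'l) set" where
  "frames = {w. (\<forall>i. w $ i \<bullet> w $ i = 1) \<and> (\<forall>i j. i \<noteq> j \<longrightarrow> w $ i \<bullet> w $ j = 0)}"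

definition theta :: "real ^ 'k \<Rightarrow> real ^ 'k ^ 'l \<Rightarrow> real ^ 'k" where
  "theta x w = x - (\<Sum>i\<in>UNIV. (w $ i \<bullet> x) *\<^sub>R w $ i)"

definition coords :: "real ^ 'k \<Rightarrow> real ^ 'k ^ 'l \<Rightarrow> real ^ 'l" where
  "coords x w = (\<chi> i. w $ i \<bullet> x)"

definition frame_point :: "real ^ 'k ^ 'l \<Rightarrow> real ^ 'k \<Rightarrow> real ^ 'l \<Rightarrow> real ^ 'k" where
  "frame_point w y u = y + (\<Sum>i\<in>UNIV. u $ i *\<^sub>R w $ i)"

definition slice_mass :: "(real ^ 'k \<Rightarrow> real) \<Rightarrow> real ^ 'k ^ 'l \<Rightarrow> real ^ 'k \<Rightarrow> ennreal" where
  "slice_mass p w y = (\<integral>\<^sup>+ u. ennreal (p (frame_point w y u)) \<partial>lborel)"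

definition regular_slice :: "(real ^ 'k \<Rightarrow> real) \<Rightarrow> real ^ 'k ^ 'l \<Rightarrow> real ^ 'k \<Rightarrow> bool" where
  "regular_slice p w y \<longleftrightarrow> 0 < slice_mass p w y \<and> slice_mass p w y < \<infinity>"

text \<open>
  The law \<open>\<phi>\<close> of the coordinates along a slice.  On the exceptional slices, where it is left undefined
  by the mathematics and which carry no \<open>\<pi>\<close>-mass for any frame, it is set to a fixed point mass, so
  that \<open>Sbar_kernel\<close> is a Markov kernel at every point.
\<close>

definition slice_law :: "(real ^ 'k \<Rightarrow> real) \<Rightarrow> real ^ 'k ^ 'l \<Rightarrow> real ^ 'k \<Rightarrow> (real ^ 'l) measure" where
  "slice_law p w y =
     (if regular_slice p w y
      then density lborel (\<lambda>u. ennreal (p (frame_point w y u)) / slice_mass p w y)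
      else return borel 0)"

definition Sbar_kernel ::
    "(real ^ 'k ^ 'l) measure \<Rightarrow> (real ^ 'k \<Rightarrow> real) \<Rightarrow> real ^ 'k \<Rightarrow> (real ^ 'k) measure" where
  "Sbar_kernel \<nu> p x =
     \<nu> \<bind> (\<lambda>w. distr (slice_law p w (theta x w)) borel (frame_point w (theta x w)))"

definition S_kernel ::
    "(real ^ 'k ^ 'l) measure \<Rightarrow> (real ^ 'k ^ 'l \<Rightarrow> real ^ 'k \<Rightarrow> real ^ 'l \<Rightarrow> (real ^ 'l) measure)
      \<Rightarrow> real ^ 'k \<Rightarrow> (real ^ 'k) measure" where
  "S_kernel \<nu> H x =
     \<nu> \<bind> (\<lambda>w. distr (H w (theta x w) (coords x w)) borel (frame_point w (theta x w)))"

end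

theory Submission
  imports Defs
begin

text \<open>
  For a kernel \<open>K\<close> with invariant law \<open>\<rho>\<close> the Dirichlet form is half the energy
  \<open>\<integral> \<integral> (f x - f y)\<^sup>2 K(x, dy) \<rho>(dx)\<close>.  Since \<open>slice_law\<close> is a regular conditional distribution of \<open>\<pi>\<close> given
  \<open>theta x w\<close>, the energy of \<open>S\<close> is the average over \<open>\<nu>(dw) \<pi>(dx)\<close> of the energies of the kernels \<open>H\<close> on
  the slices.  The kernel \<open>Sbar\<close> is the special case in which \<open>H\<close> samples exactly from \<open>slice_law\<close>, where the
  energy on a slice is twice a variance.  Hence the spectral gap inequality on almost every slice
  integrates to the comparison of the Dirichlet forms, and self-adjointness of \<open>H\<close> on almost every
  slice integrates to that of \<open>S\<close>.
\<close>

subsection \<open>Energies and spectral gaps of invariant kernels\<close>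

text \<open>A step of \<open>S\<close> stays inside the slice through \<open>x\<close>, so start and
  end share the base point \<open>theta x w\<close>. Resampling the start from
  \<open>slice_law\<close> leaves averages over \<pi> unchanged and turns start and end into a
  stationary pair of the single kernel \<open>H\<close> on that slice; this is why the energies add
  up. Three obstacles shape the details. Gap and self-adjointness speak of mean-zero functions, but
  restricting a mean-zero function to a slice can give any mean, so constants have to be split off.
  The gap of a slice is not known to be a measurable function of \<open>(w, x)\<close>, so only
  almost-everywhere bounds for it are used. The real infimum in \<open>gap\<close> says nothing over
  an empty set, so nonzero elements of \<open>L2_zero\<close> must be exhibited; this works because
  a law with a Lebesgue density is not a point mass.\<close>

definition square_integrable :: "'a measure \<Rightarrow> ('a \<Rightarrow> real) \<Rightarrow> bool" where
  "square_integrable \<rho> f \<longleftrightarrow> f \<in> borel_measurable \<rho> \<and> integrable \<rho> (\<lambda>x. (f x)\<^sup>2)"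

lemma L2_zero_iff: "f \<in> L2_zero \<rho> \<longleftrightarrow> square_integrable \<rho> f \<and> (\<integral>x. f x \<partial>\<rho>) = 0"
  by (auto simp: L2_zero_def square_integrable_def)

lemma square_integrable_measurable: "square_integrable \<rho> f \<Longrightarrow> f \<in> borel_measurable \<rho>"
  by (simp add: square_integrable_def)

lemma square_integrable_power2: "square_integrable \<rho> f \<Longrightarrow> integrable \<rho> (\<lambda>x. (f x)\<^sup>2)"
  by (simp add: square_integrable_def)

lemma square_integrable_iff_nn_integral:
  "square_integrable \<rho> f \<longleftrightarrow>
     f \<in> borel_measurable \<rho> \<and> (\<integral>\<^sup>+x. ennreal ((f x)\<^sup>2) \<partial>\<rho>) < \<infinity>"
proof -
  have "integrable \<rho> (\<lambda>x. (f x)\<^sup>2) \<longleftrightarrow> (\<integral>\<^sup>+x. ennreal ((f x)\<^sup>2) \<partial>\<rho>) < \<infinity>"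
    if [measurable]: "f \<in> borel_measurable \<rho>"
    by (subst integrable_iff_bounded) auto
  then show ?thesis
    by (auto simp: square_integrable_def)
qed

lemma square_integrable_mult:
  assumes "square_integrable \<rho> f" "square_integrable \<rho> g"
  shows "integrable \<rho> (\<lambda>x. f x * g x)"
proof -
  note [measurable] = assms[THEN square_integrable_measurable]
  show ?thesis
  proof (rule Bochner_Integration.integrable_bound)
    show "integrable \<rho> (\<lambda>x. (f x)\<^sup>2 + (g x)\<^sup>2)"
      using assms by (auto simp: square_integrable_def)
    have "\<bar>a * b\<bar> \<le> \<bar>a\<^sup>2 + b\<^sup>2\<bar>" for a b :: real
    proof -
      have "2 * \<bar>a * b\<bar> \<le> a\<^sup>2 + b\<^sup>2"
        using sum_squares_bound[of "\<bar>a\<bar>" "\<bar>b\<bar>"] by (simp add: abs_mult mult.assoc)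
      then show ?thesis by linarith
    qed
    then show "AE x in \<rho>. norm (f x * g x) \<le> norm ((f x)\<^sup>2 + (g x)\<^sup>2)"
      by auto
  qed measurable
qed

context prob_space
begin

lemma square_integrable_const: "square_integrable M (\<lambda>_. c)"
  by (simp add: square_integrable_def)

lemma square_integrable_integrable: "square_integrable M f \<Longrightarrow> integrable M f"
  using square_integrable_mult[OF _ square_integrable_const[of 1]] by simp

lemma square_integrable_add_const:
  assumes "square_integrable M f"
  shows "square_integrable M (\<lambda>x. f x + c)"
proof -
  have "integrable M (\<lambda>x. (f x)\<^sup>2 + 2 * c * f x + c\<^sup>2)"
    using assms square_integrable_integrable[OF assms] by (auto simp: square_integrable_def)
  then show ?thesis
    using assms unfolding square_integrable_def
    by (auto simp: power2_sum algebra_simps)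
qed

lemma power2_integral_le:
  assumes "square_integrable M f"
  shows "(\<integral>x. f x \<partial>M)\<^sup>2 \<le> (\<integral>x. (f x)\<^sup>2 \<partial>M)"
proof -
  have "0 \<le> variance f" by simp
  also have "variance f = (\<integral>x. (f x)\<^sup>2 \<partial>M) - (\<integral>x. f x \<partial>M)\<^sup>2"
    using assms square_integrable_integrable[OF assms]
    by (intro variance_eq) (auto simp: square_integrable_def)
  finally show ?thesis by simp
qed

lemma minus_mean_L2_zero:
  assumes "square_integrable M f"
  shows "(\<lambda>x. f x - (\<integral>x. f x \<partial>M)) \<in> L2_zero M"
  using square_integrable_add_const[OF assms, of "- (\<integral>x. f x \<partial>M)"]
    square_integrable_integrable[OF assms]
  by (simp add: L2_zero_iff prob_space)

end

text \<open>
  The diagonal value \<open>kernel_energy \<rho> K f f\<close> is twice the Dirichlet form.  Working with this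
  nonnegative double integral instead of \<open>\<langle>f, K g\<rangle>\<close> lets Tonelli's theorem be applied without
  integrability conditions, and its symmetry in \<open>f\<close> and \<open>g\<close> is equivalent to self-adjointness.
\<close>

definition kernel_energy ::
    "'a measure \<Rightarrow> ('a \<Rightarrow> 'a measure) \<Rightarrow> ('a \<Rightarrow> real) \<Rightarrow> ('a \<Rightarrow> real) \<Rightarrow> ennreal" where
  "kernel_energy \<rho> K f g = (\<integral>\<^sup>+x. \<integral>\<^sup>+y. ennreal ((f x - g y)\<^sup>2) \<partial>K x \<partial>\<rho>)"

section \<open>Kernels with an invariant law: contraction, energy and self-adjointness\<close>

locale invariant_kernel = prob_space \<rho> for \<rho> :: "'a measure" +
  fixes K :: "'a \<Rightarrow> 'a measure"
  assumes kernel: "K \<in> \<rho> \<rightarrow>\<^sub>M prob_algebra \<rho>"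
    and invariant: "\<rho> \<bind> K = \<rho>"
begin

lemma subprob_kernel [measurable]: "K \<in> \<rho> \<rightarrow>\<^sub>M subprob_algebra \<rho>"
  using kernel by (rule measurable_prob_algebraD)

lemma sets_kernel_eq: "x \<in> space \<rho> \<Longrightarrow> sets (K x) = sets \<rho>"
  using measurable_space[OF kernel] by (auto simp: space_prob_algebra)

lemma prob_space_kernel: "x \<in> space \<rho> \<Longrightarrow> prob_space (K x)"
  using measurable_space[OF kernel] by (auto simp: space_prob_algebra)

lemma measurable_kernel_op [measurable]:
  "f \<in> borel_measurable \<rho> \<Longrightarrow> kernel_op K f \<in> borel_measurable \<rho>"
  unfolding kernel_op_def
  by (rule measurable_compose[OF subprob_kernel integral_measurable_subprob_algebra])

lemma nn_integral_kernel:
  assumes "h \<in> borel_measurable \<rho>"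
  shows "(\<integral>\<^sup>+x. \<integral>\<^sup>+y. h y \<partial>K x \<partial>\<rho>) = (\<integral>\<^sup>+x. h x \<partial>\<rho>)"
  using nn_integral_bind[OF assms subprob_kernel] by (simp add: invariant)

text \<open>\<open>K x\<close> may be singular to \<rho>, so square integrability under \<rho> says
  nothing about a single \<open>x\<close>. Invariance makes the average over \<open>x\<close> of the
  second moments under \<open>K x\<close> finite, hence almost all of them.\<close>

lemma AE_square_integrable_kernel:
  assumes g: "square_integrable \<rho> g"
  shows "AE x in \<rho>. square_integrable (K x) g"
proof -
  note [measurable] = square_integrable_measurable[OF g]
  have "(\<integral>\<^sup>+x. \<integral>\<^sup>+y. ennreal ((g y)\<^sup>2) \<partial>K x \<partial>\<rho>) \<noteq> \<infinity>"
    using g by (subst nn_integral_kernel) (auto simp: square_integrable_iff_nn_integral)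
  then have "AE x in \<rho>. (\<integral>\<^sup>+y. ennreal ((g y)\<^sup>2) \<partial>K x) \<noteq> \<infinity>"
    by (intro nn_integral_PInf_AE) measurable
  with AE_space show ?thesis
    by eventually_elim
      (auto simp: square_integrable_iff_nn_integral less_top sets_kernel_eq
        cong: measurable_cong_sets)
qed

text \<open>Nonnegativity allows the passage through \<open>nn_integral\<close>. Where
  \<open>g\<close> is not integrable under \<open>K x\<close>, the integral in
  \<open>kernel_op\<close> takes its default value 0; invariance confines this to a null
  set.\<close>

lemma integral_kernel:
  assumes g: "integrable \<rho> g" and nonneg: "\<And>x. 0 \<le> g x"
  shows "integrable \<rho> (kernel_op K g)" "(\<integral>x. kernel_op K g x \<partial>\<rho>) = (\<integral>x. g x \<partial>\<rho>)"
proof -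
  have [measurable]: "g \<in> borel_measurable \<rho>" using g by auto
  have *: "(\<integral>\<^sup>+x. \<integral>\<^sup>+y. ennreal (g y) \<partial>K x \<partial>\<rho>) = ennreal (\<integral>x. g x \<partial>\<rho>)"
    using g nonneg by (subst nn_integral_kernel) (auto simp: nn_integral_eq_integral)
  then have "AE x in \<rho>. (\<integral>\<^sup>+y. ennreal (g y) \<partial>K x) \<noteq> \<infinity>"
    by (intro nn_integral_PInf_AE) auto
  with AE_space have "AE x in \<rho>. (\<integral>\<^sup>+y. ennreal (g y) \<partial>K x) = ennreal (kernel_op K g x)"
  proof eventually_elim
    case (elim x)
    then have "g \<in> borel_measurable (K x)"
      by (simp add: sets_kernel_eq cong: measurable_cong_sets)
    with elim nonneg have "integrable (K x) g"
      by (subst integrable_iff_bounded) (auto simp: less_top)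
    with nonneg show ?case
      by (simp add: nn_integral_eq_integral kernel_op_def)
  qed
  then have **: "(\<integral>\<^sup>+x. ennreal (kernel_op K g x) \<partial>\<rho>) = ennreal (\<integral>x. g x \<partial>\<rho>)"
    unfolding *[symmetric] by (intro nn_integral_cong_AE) auto
  have nn: "0 \<le> kernel_op K g x" for x
    unfolding kernel_op_def using nonneg by simp
  show "integrable \<rho> (kernel_op K g)"
    using nn by (subst integrable_iff_bounded) (auto simp: **)
  then have "ennreal (\<integral>x. kernel_op K g x \<partial>\<rho>) = ennreal (\<integral>x. g x \<partial>\<rho>)"
    using nn by (subst **[symmetric]) (auto simp: nn_integral_eq_integral)
  then show "(\<integral>x. kernel_op K g x \<partial>\<rho>) = (\<integral>x. g x \<partial>\<rho>)"
    using nn nonneg by (subst (asm) ennreal_inj) auto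
qed

text \<open>Jensen's inequality under \<open>K x\<close> bounds the square of
  \<open>kernel_op K g\<close> by \<open>kernel_op K\<close> applied to the square of
  \<open>g\<close>, which is integrable by invariance.\<close>

lemma square_integrable_kernel_op:
  assumes g: "square_integrable \<rho> g"
  shows "square_integrable \<rho> (kernel_op K g)"
proof -
  note [measurable] = square_integrable_measurable[OF g]
  have "integrable \<rho> (kernel_op K (\<lambda>x. (g x)\<^sup>2))"
    using g by (intro integral_kernel) (auto simp: square_integrable_def)
  then have "integrable \<rho> (\<lambda>x. (kernel_op K g x)\<^sup>2)"
  proof (rule Bochner_Integration.integrable_bound)
    show "AE x in \<rho>. norm ((kernel_op K g x)\<^sup>2) \<le> norm (kernel_op K (\<lambda>x. (g x)\<^sup>2) x)"
      using AE_square_integrable_kernel[OF g] AE_space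
    proof eventually_elim
      case (elim x)
      then show ?case
        using prob_space.power2_integral_le[OF prob_space_kernel] by (simp add: kernel_op_def)
    qed
  qed measurable
  then show ?thesis
    by (auto simp: square_integrable_def)
qed

text \<open>Expand the square; invariance turns the averaged second moment of \<open>g\<close> under
  \<open>K x\<close> into that under \<rho>. The second part is recorded because
  \<open>ennreal\<close> truncates at 0: only with it can equal energies be read back as equal real
  numbers.\<close>

lemma kernel_energy_eq:
  assumes f: "square_integrable \<rho> f" and g: "square_integrable \<rho> g"
  shows "kernel_energy \<rho> K f g =
      ennreal ((\<integral>x. (f x)\<^sup>2 \<partial>\<rho>) + (\<integral>x. (g x)\<^sup>2 \<partial>\<rho>) - 2 * L2_inner \<rho> f (kernel_op K g))"
    and "0 \<le> (\<integral>x. (f x)\<^sup>2 \<partial>\<rho>) + (\<integral>x. (g x)\<^sup>2 \<partial>\<rho>) - 2 * L2_inner \<rho> f (kernel_op K g)"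
proof -
  note [measurable] = assms[THEN square_integrable_measurable]
  define D where "D x = (f x)\<^sup>2 - 2 * (f x * kernel_op K g x) + kernel_op K (\<lambda>y. (g y)\<^sup>2) x" for x
  have *: "AE x in \<rho>. 0 \<le> D x \<and> (\<integral>\<^sup>+y. ennreal ((f x - g y)\<^sup>2) \<partial>K x) = ennreal (D x)"
    using AE_square_integrable_kernel[OF g] AE_space
  proof eventually_elim
    case (elim x)
    interpret Kx: prob_space "K x" using elim(2) by (rule prob_space_kernel)
    have int: "integrable (K x) g" "integrable (K x) (\<lambda>y. (g y)\<^sup>2)"
      using Kx.square_integrable_integrable[OF elim(1)] square_integrable_power2[OF elim(1)] .
    have eq: "(\<lambda>y. (f x - g y)\<^sup>2) = (\<lambda>y. (f x)\<^sup>2 - 2 * f x * g y + (g y)\<^sup>2)"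
      by (auto simp: power2_diff)
    have i: "integrable (K x) (\<lambda>y. (f x - g y)\<^sup>2)"
      unfolding eq using int by auto
    have D: "D x = (\<integral>y. (f x - g y)\<^sup>2 \<partial>K x)"
      unfolding eq D_def kernel_op_def using int by (simp add: Kx.prob_space)
    show ?case
      unfolding D using i by (simp add: nn_integral_eq_integral)
  qed
  have int: "integrable \<rho> (\<lambda>x. (f x)\<^sup>2)" "integrable \<rho> (\<lambda>x. (g x)\<^sup>2)"
      "integrable \<rho> (\<lambda>x. f x * kernel_op K g x)"
      "integrable \<rho> (kernel_op K (\<lambda>y. (g y)\<^sup>2))"
    using square_integrable_power2[OF f] square_integrable_power2[OF g]
      square_integrable_mult[OF f square_integrable_kernel_op[OF g]]
      integral_kernel(1)[OF square_integrable_power2[OF g] zero_le_power2] .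
  have iD: "integrable \<rho> D" unfolding D_def using int by auto
  have D: "(\<integral>x. D x \<partial>\<rho>) =
      (\<integral>x. (f x)\<^sup>2 \<partial>\<rho>) + (\<integral>x. (g x)\<^sup>2 \<partial>\<rho>) - 2 * L2_inner \<rho> f (kernel_op K g)"
    unfolding D_def L2_inner_def using int integral_kernel(2)[OF int(2)] by simp
  have "kernel_energy \<rho> K f g = (\<integral>\<^sup>+x. ennreal (D x) \<partial>\<rho>)"
    unfolding kernel_energy_def using * by (intro nn_integral_cong_AE) auto
  also have "\<dots> = ennreal (\<integral>x. D x \<partial>\<rho>)"
    using iD * by (intro nn_integral_eq_integral) auto
  finally show "kernel_energy \<rho> K f g =
      ennreal ((\<integral>x. (f x)\<^sup>2 \<partial>\<rho>) + (\<integral>x. (g x)\<^sup>2 \<partial>\<rho>) - 2 * L2_inner \<rho> f (kernel_op K g))"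
    unfolding D .
  show "0 \<le> (\<integral>x. (f x)\<^sup>2 \<partial>\<rho>) + (\<integral>x. (g x)\<^sup>2 \<partial>\<rho>) - 2 * L2_inner \<rho> f (kernel_op K g)"
    unfolding D[symmetric] using * by (intro integral_nonneg_AE) auto
qed

lemma L2_norm_power2: "(L2_norm \<rho> f)\<^sup>2 = (\<integral>x. (f x)\<^sup>2 \<partial>\<rho>)"
  by (simp add: L2_norm_def L2_inner_def flip: power2_eq_square)

lemma kernel_energy_diag:
  assumes f: "square_integrable \<rho> f"
  shows "kernel_energy \<rho> K f f = ennreal (2 * dirichlet_form \<rho> (kernel_op K) f)"
    and "0 \<le> dirichlet_form \<rho> (kernel_op K) f"
  using kernel_energy_eq[OF f f] by (simp_all add: dirichlet_form_def L2_norm_power2 algebra_simps)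

text \<open>The energy of the pair \<open>f\<close>, \<open>- f\<close> is nonnegative, which bounds
  the inner product of \<open>f\<close> and \<open>kernel_op K f\<close> below by minus the squared
  norm.\<close>

lemma dirichlet_form_le:
  assumes f: "square_integrable \<rho> f"
  shows "dirichlet_form \<rho> (kernel_op K) f \<le> 2 * (L2_norm \<rho> f)\<^sup>2"
proof -
  have g: "square_integrable \<rho> (\<lambda>x. - f x)"
    using f by (auto simp: square_integrable_def)
  have "kernel_op K (\<lambda>x. - f x) = (\<lambda>x. - kernel_op K f x)"
    by (auto simp: kernel_op_def)
  with kernel_energy_eq(2)[OF f g] show ?thesis
    by (simp add: dirichlet_form_def L2_norm_power2 L2_inner_def)
qed

text \<open>For \<open>g\<close> of varying sign the mean is read off from the energy of the pair
  \<open>1\<close>, \<open>g\<close>, evaluated twice: by invariance it is the integral of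
  \<open>(1 - g x)\<^sup>2\<close>, and by \<open>kernel_energy_eq\<close> the mean of
  \<open>kernel_op K g\<close> appears in the cross term.\<close>

lemma integral_kernel_op:
  assumes g: "square_integrable \<rho> g"
  shows "(\<integral>x. kernel_op K g x \<partial>\<rho>) = (\<integral>x. g x \<partial>\<rho>)"
proof -
  note [measurable] = square_integrable_measurable[OF g]
  have ig: "integrable \<rho> g" by (rule square_integrable_integrable[OF g])
  have "kernel_energy \<rho> K (\<lambda>_. 1) g = (\<integral>\<^sup>+x. ennreal ((1 - g x)\<^sup>2) \<partial>\<rho>)"
    unfolding kernel_energy_def by (rule nn_integral_kernel) simp
  also have "(\<lambda>x. (1 - g x)\<^sup>2) = (\<lambda>x. 1 - 2 * g x + (g x)\<^sup>2)"
    by (auto simp: power2_diff)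
  finally have eq: "kernel_energy \<rho> K (\<lambda>_. 1) g = (\<integral>\<^sup>+x. ennreal (1 - 2 * g x + (g x)\<^sup>2) \<partial>\<rho>)"
    by meson
  have nn: "0 \<le> 1 - 2 * g x + (g x)\<^sup>2" for x
    using zero_le_power2[of "1 - g x"] by (simp add: power2_diff)
  have i: "integrable \<rho> (\<lambda>x. 1 - 2 * g x + (g x)\<^sup>2)"
    using ig g by (auto simp: square_integrable_def)
  have "ennreal (\<integral>x. 1 - 2 * g x + (g x)\<^sup>2 \<partial>\<rho>) =
      ennreal (1 + (\<integral>x. (g x)\<^sup>2 \<partial>\<rho>) - 2 * (\<integral>x. kernel_op K g x \<partial>\<rho>))"
    using kernel_energy_eq(1)[OF square_integrable_const[of 1] g] i nn
    unfolding eq by (subst (asm) nn_integral_eq_integral) (auto simp: L2_inner_def prob_space)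
  then have "(\<integral>x. 1 - 2 * g x + (g x)\<^sup>2 \<partial>\<rho>) =
      1 + (\<integral>x. (g x)\<^sup>2 \<partial>\<rho>) - 2 * (\<integral>x. kernel_op K g x \<partial>\<rho>)"
    using nn kernel_energy_eq(2)[OF square_integrable_const[of 1] g]
    by (subst (asm) ennreal_inj) (auto simp: L2_inner_def prob_space)
  then show ?thesis
    using ig g by (simp add: square_integrable_def prob_space)
qed

text \<open>\<open>K\<close> fixes constants and preserves means, so the constant and mean-zero
  parts do not interact. The extra term is symmetric in \<open>f\<close> and \<open>g\<close>, which
  extends self-adjointness from \<open>L2_zero\<close> to all square-integrable functions.\<close>

lemma L2_inner_kernel_op_centered:
  assumes f: "square_integrable \<rho> f" and g: "square_integrable \<rho> g"
  shows "L2_inner \<rho> f (kernel_op K g) =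
    L2_inner \<rho> (\<lambda>x. f x - (\<integral>x. f x \<partial>\<rho>)) (kernel_op K (\<lambda>x. g x - (\<integral>x. g x \<partial>\<rho>)))
      + (\<integral>x. f x \<partial>\<rho>) * (\<integral>x. g x \<partial>\<rho>)"
proof -
  note [measurable] = assms[THEN square_integrable_measurable]
  define a where "a = (\<integral>x. f x \<partial>\<rho>)"
  define b where "b = (\<integral>x. g x \<partial>\<rho>)"
  note Kg = square_integrable_kernel_op[OF g]
  have int: "integrable \<rho> f" "integrable \<rho> (kernel_op K g)" "integrable \<rho> (\<lambda>x. f x * kernel_op K g x)"
    using square_integrable_integrable[OF f] square_integrable_integrable[OF Kg]
      square_integrable_mult[OF f Kg] .
  have "AE x in \<rho>. kernel_op K (\<lambda>x. g x - b) x = kernel_op K g x - b"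
    using AE_square_integrable_kernel[OF g] AE_space
  proof eventually_elim
    case (elim x)
    interpret Kx: prob_space "K x" using elim(2) by (rule prob_space_kernel)
    show ?case
      using Kx.square_integrable_integrable[OF elim(1)] by (simp add: kernel_op_def Kx.prob_space)
  qed
  then have "L2_inner \<rho> (\<lambda>x. f x - a) (kernel_op K (\<lambda>x. g x - b)) =
      (\<integral>x. (f x - a) * (kernel_op K g x - b) \<partial>\<rho>)"
    unfolding L2_inner_def by (intro integral_cong_AE) auto
  also have "(\<lambda>x. (f x - a) * (kernel_op K g x - b)) =
      (\<lambda>x. f x * kernel_op K g x - b * f x - a * kernel_op K g x + a * b)"
    by (auto simp: algebra_simps)
  also have "(\<integral>x. f x * kernel_op K g x - b * f x - a * kernel_op K g x + a * b \<partial>\<rho>) =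
      L2_inner \<rho> f (kernel_op K g) - b * a - a * b + a * b"
    using int integral_kernel_op[OF g] by (simp add: prob_space L2_inner_def a_def b_def)
  finally show ?thesis
    by (simp add: a_def b_def)
qed

text \<open>No mean is prescribed for \<open>f\<close> and \<open>g\<close>, because this is applied
  to restrictions of functions to slices.\<close>

lemma kernel_energy_commute:
  assumes "self_adjoint_on_L2_zero \<rho> (kernel_op K)"
    and f: "square_integrable \<rho> f" and g: "square_integrable \<rho> g"
  shows "kernel_energy \<rho> K f g = kernel_energy \<rho> K g f"
proof -
  have "L2_inner \<rho> f (kernel_op K g) = L2_inner \<rho> g (kernel_op K f)"
  proof -
    have sym: "L2_inner \<rho> u v = L2_inner \<rho> v u" for u v
      by (simp add: L2_inner_def mult.commute)
    show ?thesis
      using assms(1) minus_mean_L2_zero[OF f] minus_mean_L2_zero[OF g] sym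
      unfolding self_adjoint_on_L2_zero_def
        L2_inner_kernel_op_centered[OF f g] L2_inner_kernel_op_centered[OF g f]
      by (simp add: mult.commute)
  qed
  then show ?thesis
    unfolding kernel_energy_eq(1)[OF f g] kernel_energy_eq(1)[OF g f]
    by (simp add: add.commute)
qed

lemma self_adjointI:
  assumes commute: "\<And>f g. square_integrable \<rho> f \<Longrightarrow> square_integrable \<rho> g \<Longrightarrow>
    kernel_energy \<rho> K f g = kernel_energy \<rho> K g f"
  shows "self_adjoint_on_L2_zero \<rho> (kernel_op K)"
  unfolding self_adjoint_on_L2_zero_def
proof (intro ballI)
  fix f g assume "f \<in> L2_zero \<rho>" "g \<in> L2_zero \<rho>"
  then have f: "square_integrable \<rho> f" and g: "square_integrable \<rho> g"
    by (auto simp: L2_zero_iff)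
  have "L2_inner \<rho> f (kernel_op K g) = L2_inner \<rho> g (kernel_op K f)"
    using commute[OF f g] kernel_energy_eq(2)[OF f g] kernel_energy_eq(2)[OF g f]
    unfolding kernel_energy_eq(1)[OF f g] kernel_energy_eq(1)[OF g f]
    by (subst (asm) ennreal_inj) auto
  then show "L2_inner \<rho> f (kernel_op K g) = L2_inner \<rho> (kernel_op K f) g"
    by (simp add: L2_inner_def mult.commute)
qed

lemma reversibleI:
  assumes "\<And>f g. square_integrable \<rho> f \<Longrightarrow> square_integrable \<rho> g \<Longrightarrow>
    kernel_energy \<rho> K f g = kernel_energy \<rho> K g f"
  shows "reversible \<rho> K"
  using self_adjointI[OF assms] kernel invariant by (simp add: reversible_def markov_kernel_def)

section \<open>Bounds for the spectral gap\<close>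

lemma bdd_below_dirichlet_quotient:
  "bdd_below ((\<lambda>f. dirichlet_form \<rho> (kernel_op K) f / (L2_norm \<rho> f)\<^sup>2) `
     {f \<in> L2_zero \<rho>. \<not> (AE x in \<rho>. f x = 0)})"
  using kernel_energy_diag(2) by (intro bdd_belowI[of _ 0]) (auto simp: L2_zero_iff)

lemma gap_le_quotient:
  assumes "f \<in> L2_zero \<rho>" "\<not> (AE x in \<rho>. f x = 0)"
  shows "gap \<rho> (kernel_op K) \<le> dirichlet_form \<rho> (kernel_op K) f / (L2_norm \<rho> f)\<^sup>2"
  unfolding gap_def using assms by (intro cINF_lower[OF bdd_below_dirichlet_quotient]) auto

lemma L2_norm_power2_eq_0_iff:
  assumes "square_integrable \<rho> f"
  shows "(L2_norm \<rho> f)\<^sup>2 = 0 \<longleftrightarrow> (AE x in \<rho>. f x = 0)"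
  using integral_nonneg_eq_0_iff_AE[OF square_integrable_power2[OF assms]]
  by (simp add: L2_norm_power2)

lemma gap_le_2:
  assumes f: "f \<in> L2_zero \<rho>" "\<not> (AE x in \<rho>. f x = 0)"
  shows "gap \<rho> (kernel_op K) \<le> 2"
proof -
  have sq: "square_integrable \<rho> f" using f by (simp add: L2_zero_iff)
  have "0 < (L2_norm \<rho> f)\<^sup>2"
    using f L2_norm_power2_eq_0_iff[OF sq] by (metis zero_less_power2 power2_eq_iff zero_power2)
  then have "dirichlet_form \<rho> (kernel_op K) f / (L2_norm \<rho> f)\<^sup>2 \<le> 2"
    using dirichlet_form_le[OF sq] by (simp add: pos_divide_le_eq)
  with gap_le_quotient[OF f] show ?thesis by linarith
qed

text \<open>The witness \<open>f\<close> shows that the infimum ranges over a nonempty set;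
  otherwise the nonnegative quotients would not bound it.\<close>

lemma gap_nonneg:
  assumes f: "f \<in> L2_zero \<rho>" "\<not> (AE x in \<rho>. f x = 0)"
  shows "0 \<le> gap \<rho> (kernel_op K)"
  unfolding gap_def using f kernel_energy_diag(2)
  by (intro cINF_greatest) (auto simp: L2_zero_iff)

end

section \<open>Exact sampling and nontriviality of the mean-zero space\<close>

lemma (in prob_space) invariant_kernel_const: "invariant_kernel M (\<lambda>_. M)"
proof
  have M: "M \<in> space (prob_algebra M)"
    by (simp add: space_prob_algebra prob_space_axioms)
  then show "(\<lambda>_. M) \<in> M \<rightarrow>\<^sub>M prob_algebra M" by simp
  show "M \<bind> (\<lambda>_. M) = M"
    by (rule bind_const'[OF prob_space_axioms]) (simp add: prob_space_imp_subprob_space prob_space_axioms)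
qed

lemma (in prob_space) L2_inner_kernel_op_const:
  "L2_inner M f (kernel_op (\<lambda>_. M) g) = (\<integral>x. f x \<partial>M) * (\<integral>x. g x \<partial>M)"
  by (simp add: L2_inner_def kernel_op_def)

lemma (in prob_space) reversible_const: "reversible M (\<lambda>_. M)"
proof -
  interpret K: invariant_kernel M "\<lambda>_. M" by (rule invariant_kernel_const)
  show ?thesis
    using K.kernel K.invariant
    by (auto simp: reversible_def markov_kernel_def self_adjoint_on_L2_zero_def
        L2_inner_kernel_op_const L2_inner_def kernel_op_def)
qed

text \<open>
  The energy of the kernel \<open>\<lambda>_. \<rho>\<close> is twice the variance, so this is a Poincare inequality.
\<close>

lemma (in invariant_kernel) gap_mult_kernel_energy_const_le:
  assumes f: "square_integrable \<rho> f" and c: "0 \<le> c" "c \<le> gap \<rho> (kernel_op K)"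
  shows "ennreal c * kernel_energy \<rho> (\<lambda>_. \<rho>) f f \<le> kernel_energy \<rho> K f f"
proof -
  interpret C: invariant_kernel \<rho> "\<lambda>_. \<rho>" by (rule invariant_kernel_const)
  define m where "m = (\<integral>x. f x \<partial>\<rho>)"
  define h where "h = (\<lambda>x. f x - m)"
  have h0: "h \<in> L2_zero \<rho>" unfolding h_def m_def by (rule minus_mean_L2_zero[OF f])
  then have h: "square_integrable \<rho> h" "(\<integral>x. h x \<partial>\<rho>) = 0" by (auto simp: L2_zero_iff)
  \<comment> \<open>Subtracting the mean changes no difference \<open>f x - f y\<close>, and it
    brings \<open>f\<close> into the range of the gap.\<close>
  have shift: "kernel_energy \<rho> J f f = kernel_energy \<rho> J h h" for J
    by (simp add: kernel_energy_def h_def)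
  have C: "dirichlet_form \<rho> (kernel_op (\<lambda>_. \<rho>)) h = (L2_norm \<rho> h)\<^sup>2"
    by (simp add: dirichlet_form_def L2_inner_kernel_op_const h)
  have "c * (L2_norm \<rho> h)\<^sup>2 \<le> dirichlet_form \<rho> (kernel_op K) h"
  proof (cases "(L2_norm \<rho> h)\<^sup>2 = 0")
    case True
    then show ?thesis using kernel_energy_diag(2)[OF h(1)] by simp
  next
    case False
    then have "0 < (L2_norm \<rho> h)\<^sup>2" by (metis zero_less_power2 zero_power2)
    moreover have "c \<le> dirichlet_form \<rho> (kernel_op K) h / (L2_norm \<rho> h)\<^sup>2"
      using gap_le_quotient[OF h0] False L2_norm_power2_eq_0_iff[OF h(1)] c by auto
    ultimately show ?thesis by (simp add: pos_le_divide_eq)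
  qed
  then show ?thesis
    unfolding shift kernel_energy_diag(1)[OF h(1)] C.kernel_energy_diag(1)[OF h(1)] C
    using c by (simp add: ennreal_mult[symmetric] ennreal_leI)
qed

text \<open>The arctangent of one coordinate is bounded, hence square integrable under every
  probability law. If it were almost surely equal to its mean \<open>m\<close>, the law would live
  on the hyperplane where that coordinate is \<open>tan m\<close>, a Lebesgue null set.\<close>

lemma exists_nonzero_L2_zero:
  fixes g :: "real ^ 'n \<Rightarrow> ennreal"
  assumes g: "g \<in> borel_measurable borel" and prob: "prob_space (density lborel g)"
  shows "\<exists>f \<in> L2_zero (density lborel g). \<not> (AE x in density lborel g. f x = 0)"
proof -
  let ?M = "density lborel g"
  interpret prob_space ?M by (rule prob)
  fix i :: 'n
  let ?a = "\<lambda>x :: real ^ 'n. arctan (x $ i)"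
  have [measurable]: "?a \<in> borel_measurable borel"
    by (intro borel_measurable_continuous_onI continuous_intros)
  have sq: "square_integrable ?M ?a"
    unfolding square_integrable_def
  proof
    have "\<bar>(arctan y)\<^sup>2\<bar> \<le> (pi/2)\<^sup>2" for y
    proof -
      have "\<bar>arctan y\<bar> \<le> \<bar>pi / 2\<bar>"
        using arctan_bounded[of y] by linarith
      then show ?thesis
        by (simp only: abs_le_square_iff abs_power2)
    qed
    then show "integrable ?M (\<lambda>x. (?a x)\<^sup>2)"
      by (intro integrable_const_bound[of _ "(pi/2)\<^sup>2"]) auto
  qed measurable
  define m where "m = (\<integral>x. ?a x \<partial>?M)"
  have "\<not> (AE x in ?M. ?a x - m = 0)"
  proof
    assume ae: "AE x in ?M. ?a x - m = 0"
    have "{x :: real ^ 'n. x $ i = tan m} \<in> null_sets lborel"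
    proof -
      have "negligible {x :: real ^ 'n. axis i 1 \<bullet> x = tan m}"
        by (rule negligible_hyperplane) (simp add: axis_eq_axis)
      moreover have "{x :: real ^ 'n. axis i 1 \<bullet> x = tan m} = {x. x $ i = tan m}"
        by (simp add: inner_axis' )
      moreover have "closed {x :: real ^ 'n. x $ i = tan m}"
        by (intro closed_Collect_eq continuous_intros)
      ultimately show ?thesis
        by (simp add: negligible_iff_null_sets null_sets_completion_iff)
    qed
    then have "AE x in lborel. (x :: real ^ 'n) $ i \<noteq> tan m"
      by (rule AE_I') auto
    then have "AE x in ?M. x $ i \<noteq> tan m"
      using g by (subst AE_density) auto
    with ae have "AE x in ?M. False"
      by eventually_elim (auto simp: tan_arctan dest: arg_cong[where f=tan])
    then show False by simp
  qed
  then show ?thesis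
    unfolding m_def by (rule bexI[OF _ minus_mean_L2_zero[OF sq]])
qed

subsection \<open>Disintegration along slices\<close>

lemma nn_integral_lborel_translate:
  fixes c :: "'a :: euclidean_space"
  assumes [measurable]: "g \<in> borel_measurable borel"
  shows "(\<integral>\<^sup>+x. g (x + c) \<partial>lborel) = (\<integral>\<^sup>+x. g x \<partial>lborel)"
  by (subst lborel_distr_plus[of c, symmetric], subst nn_integral_distr) (auto simp: add.commute)

lemma nn_integral_lborel_uminus:
  fixes g :: "'a :: euclidean_space \<Rightarrow> ennreal"
  assumes [measurable]: "g \<in> borel_measurable borel"
  shows "(\<integral>\<^sup>+x. g (- x) \<partial>lborel) = (\<integral>\<^sup>+x. g x \<partial>lborel)"
  by (subst (2) lborel_affine[of "-1" 0])
    (simp_all add: nn_integral_density nn_integral_distr)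

lemma borel_measurable_vec_nth [measurable (raw)]:
  fixes f :: "'a \<Rightarrow> 'b :: euclidean_space ^ 'n"
  assumes "f \<in> borel_measurable M"
  shows "(\<lambda>x. f x $ i) \<in> borel_measurable M"
  by (rule borel_measurable_continuous_on[OF _ assms]) (intro continuous_intros)

lemma borel_measurable_frame_point [measurable (raw)]:
  fixes f :: "'a \<Rightarrow> real ^ 'k ^ 'l"
  assumes [measurable]: "f \<in> borel_measurable M" "g \<in> borel_measurable M" "h \<in> borel_measurable M"
  shows "(\<lambda>x. frame_point (f x) (g x) (h x)) \<in> borel_measurable M"
  unfolding frame_point_def by measurable

lemma borel_measurable_theta [measurable (raw)]:
  fixes f :: "'a \<Rightarrow> real ^ 'k ^ 'l"
  assumes [measurable]: "f \<in> borel_measurable M" "g \<in> borel_measurable M"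
  shows "(\<lambda>x. theta (g x) (f x)) \<in> borel_measurable M"
  unfolding theta_def by measurable

lemma borel_measurable_coords [measurable (raw)]:
  fixes f :: "'a \<Rightarrow> real ^ 'k ^ 'l"
  assumes [measurable]: "f \<in> borel_measurable M" "g \<in> borel_measurable M"
  shows "(\<lambda>x. coords (g x) (f x)) \<in> borel_measurable M"
proof -
  have "coords (g x) (f x) = (\<Sum>i\<in>UNIV. (f x $ i \<bullet> g x) *\<^sub>R axis i 1)" for x
    by (simp add: coords_def vec_eq_iff axis_def if_distrib sum.delta cong: if_cong)
  then show ?thesis by simp
qed

section \<open>Algebra of slices\<close>

lemma frame_point_add: "frame_point w (frame_point w y u) v = frame_point w y (u + v)"
  by (simp add: frame_point_def scaleR_add_left sum.distrib add.assoc)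

text \<open>Replaces the base point \<open>theta x w\<close> by \<open>x\<close> at the price of a
  translation of \<open>u\<close>, which Lebesgue integrals over the slice do not see.\<close>

lemma frame_point_theta: "frame_point w (theta x w) u = frame_point w x (u - coords x w)"
  by (simp add: frame_point_def theta_def coords_def scaleR_diff_left sum_subtractf)

lemma coords_frame_point:
  fixes w :: "real ^ 'k ^ 'l"
  assumes "w \<in> frames"
  shows "coords (frame_point w y u) w = coords y w + u"
proof -
  have "w $ i \<bullet> (\<Sum>j\<in>UNIV. u $ j *\<^sub>R w $ j) = u $ i" for i
  proof -
    have "w $ i \<bullet> (\<Sum>j\<in>UNIV. u $ j *\<^sub>R w $ j) = (\<Sum>j\<in>UNIV. if j = i then u $ j else 0)"
      unfolding inner_sum_right using assms by (intro sum.cong) (auto simp: frames_def)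
    then show ?thesis by simp
  qed
  then show ?thesis
    by (simp add: coords_def frame_point_def vec_eq_iff inner_add_right)
qed

lemma theta_frame_point:
  assumes "w \<in> frames"
  shows "theta (frame_point w y u) w = theta y w"
proof -
  have "theta x w = frame_point w x (- coords x w)" for x
    using frame_point_theta[of w x 0] by (simp add: frame_point_def)
  then show ?thesis
    using assms by (simp add: frame_point_add coords_frame_point)
qed

text \<open>Together with \<open>theta_theta\<close>, a point of a slice gives back its base point
  and its coordinates, so a step of \<open>S\<close> started there uses the same slice kernel at
  \<open>u\<close>.\<close>

lemma coords_theta:
  assumes "w \<in> frames"
  shows "coords (frame_point w (theta x w) u) w = u"
  using assms by (simp add: frame_point_theta coords_frame_point)

lemma theta_theta:
  assumes "w \<in> frames"
  shows "theta (frame_point w (theta x w) u) w = theta x w"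
  using assms by (simp add: frame_point_theta theta_frame_point)

text \<open>
  Mass transport along the directions of \<open>w\<close>: it only uses the translation invariance of Lebesgue
  measure, so no orthogonal complement of the frame has to be chosen.
\<close>

lemma nn_integral_frame_swap:
  fixes w :: "real ^ 'k ^ 'l" and F :: "real ^ 'k \<Rightarrow> real ^ 'k \<Rightarrow> ennreal"
  assumes [measurable]: "case_prod F \<in> borel_measurable (borel \<Otimes>\<^sub>M borel)"
  shows "(\<integral>\<^sup>+x. \<integral>\<^sup>+u. F x (frame_point w x u) \<partial>lborel \<partial>lborel) =
    (\<integral>\<^sup>+x. \<integral>\<^sup>+u. F (frame_point w x u) x \<partial>lborel \<partial>lborel)"
proof -
  define W where "W u = frame_point w 0 u" for u
  have W: "frame_point w x u = x + W u" for x u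
    by (simp add: W_def frame_point_def)
  have W_uminus: "W (- u) = - W u" for u
    by (simp add: W_def frame_point_def sum_negf)
  have [measurable]: "W \<in> borel_measurable borel"
    unfolding W_def by measurable
  have "(\<integral>\<^sup>+x. \<integral>\<^sup>+u. F x (x + W u) \<partial>lborel \<partial>lborel) = (\<integral>\<^sup>+u. \<integral>\<^sup>+x. F x (x + W u) \<partial>lborel \<partial>lborel)"
    by (rule lborel_pair.Fubini') measurable
  also have "\<dots> = (\<integral>\<^sup>+u. \<integral>\<^sup>+x. F (x + W (- u)) x \<partial>lborel \<partial>lborel)"
  proof (rule nn_integral_cong)
    fix u :: "real ^ 'l"
    \<comment> \<open>For fixed \<open>u\<close>, translating by \<open>- W u\<close> makes the end
      point the integration variable; the reflection of \<open>u\<close> below then restores the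
      sign.\<close>
    show "(\<integral>\<^sup>+x. F x (x + W u) \<partial>lborel) = (\<integral>\<^sup>+x. F (x + W (- u)) x \<partial>lborel)"
      using nn_integral_lborel_translate[of "\<lambda>x. F x (x + W u)" "W (- u)"]
      by (simp add: W_uminus)
  qed
  also have "\<dots> = (\<integral>\<^sup>+u. \<integral>\<^sup>+x. F (x + W u) x \<partial>lborel \<partial>lborel)"
    by (rule nn_integral_lborel_uminus[of "\<lambda>u. \<integral>\<^sup>+x. F (x + W u) x \<partial>lborel"]) measurable
  also have "\<dots> = (\<integral>\<^sup>+x. \<integral>\<^sup>+u. F (x + W u) x \<partial>lborel \<partial>lborel)"
    by (rule lborel_pair.Fubini'[symmetric]) measurable
  finally show ?thesis
    by (simp add: W)
qed

section \<open>Slice laws as conditional laws\<close>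

lemma borel_measurable_slice_mass [measurable (raw)]:
  fixes f :: "'a \<Rightarrow> real ^ 'k ^ 'l"
  assumes p [measurable]: "p \<in> borel_measurable borel"
    and [measurable]: "f \<in> borel_measurable M" "g \<in> borel_measurable M"
  shows "(\<lambda>x. slice_mass p (f x) (g x)) \<in> borel_measurable M"
  unfolding slice_mass_def by measurable

lemma slice_mass_theta:
  assumes [measurable]: "p \<in> borel_measurable borel"
  shows "slice_mass p w (theta x w) = (\<integral>\<^sup>+u. ennreal (p (frame_point w x u)) \<partial>lborel)"
  using nn_integral_lborel_translate[of "\<lambda>u. ennreal (p (frame_point w x u))" "- coords x w"]
  by (simp add: slice_mass_def frame_point_theta)

lemma sets_slice_law [simp, measurable_cong]: "sets (slice_law p w y) = sets borel"
  by (simp add: slice_law_def)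

lemma prob_space_slice_law:
  assumes [measurable]: "p \<in> borel_measurable borel"
  shows "prob_space (slice_law p w y)"
proof (cases "regular_slice p w y")
  case True
  have "(\<integral>\<^sup>+u. ennreal (p (frame_point w y u)) / slice_mass p w y \<partial>lborel) =
      slice_mass p w y / slice_mass p w y"
    unfolding slice_mass_def by (rule nn_integral_divide) measurable
  also have "\<dots> = 1"
    using True by (auto simp: regular_slice_def intro: ennreal_divide_self)
  finally show ?thesis
    using True by (auto intro!: prob_spaceI simp: slice_law_def emeasure_density)
next
  case False
  then show ?thesis by (simp add: slice_law_def prob_space_return)
qed

text \<open>The slice mass \<open>m\<close> is constant along a slice, whose Lebesgue measure is
  infinite, so integrating \<open>m\<close> itself over all \<open>x\<close> would give infinity.
  The strictly positive weight \<open>q\<close> with finite integral \<open>c\<close> makes this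
  integral finite while keeping every point visible.\<close>

lemma AE_regular_slice:
  fixes p :: "real ^ 'k \<Rightarrow> real" and w :: "real ^ 'k ^ 'l"
  assumes p [measurable]: "p \<in> borel_measurable borel"
    and int: "(\<integral>\<^sup>+x. ennreal (p x) \<partial>lborel) = 1" and w: "w \<in> frames"
  shows "AE x in density lborel (\<lambda>x. ennreal (p x)). regular_slice p w (theta x w)"
proof -
  obtain q :: "real ^ 'l \<Rightarrow> ennreal" where [measurable]: "q \<in> borel_measurable borel"
    and q: "integral\<^sup>N lborel q \<noteq> \<infinity>" "\<And>u. 0 < q u" "\<And>u. q u < \<infinity>"
    using sigma_finite_measure.Ex_finite_integrable_function[OF sigma_finite_lborel] by auto
  define c where "c = integral\<^sup>N lborel q"
  have c: "c \<noteq> 0"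
  proof
    assume "c = 0"
    then have "AE u in lborel. q u = 0"
      unfolding c_def by (subst (asm) nn_integral_0_iff_AE) auto
    then have "AE u :: real ^ 'l in lborel. False"
    proof eventually_elim
      case (elim u)
      with q(2)[of u] show ?case by simp
    qed
    then have "emeasure (lborel :: (real ^ 'l) measure) UNIV = 0"
      by (subst (asm) AE_iff_measurable[OF _ refl]) auto
    then show False by simp
  qed
  define m where "m x = slice_mass p w (theta x w)" for x
  have [measurable]: "m \<in> borel_measurable borel"
    unfolding m_def by measurable
  have m: "m x = (\<integral>\<^sup>+u. ennreal (p (frame_point w x u)) \<partial>lborel)" for x
    unfolding m_def by (rule slice_mass_theta) measurable
  have m_frame_point: "m (frame_point w x u) = m x" for x u
    by (simp add: m_def theta_frame_point[OF w])
  \<comment> \<open>After the swap \<open>m\<close> is unchanged and only \<open>q\<close> depends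
    on \<open>u\<close>, through a shift by the coordinates; its integral is
    \<open>c\<close>.\<close>
  have transport: "(\<integral>\<^sup>+x. g (m x) * q (coords x w) * m x \<partial>lborel) =
      (\<integral>\<^sup>+x. c * (g (m x) * ennreal (p x)) \<partial>lborel)"
    if [measurable]: "g \<in> borel_measurable borel" for g :: "ennreal \<Rightarrow> ennreal"
  proof -
    have "(\<integral>\<^sup>+x. g (m x) * q (coords x w) * m x \<partial>lborel) =
        (\<integral>\<^sup>+x. \<integral>\<^sup>+u. g (m x) * q (coords x w) * ennreal (p (frame_point w x u)) \<partial>lborel \<partial>lborel)"
      by (subst nn_integral_cmult) (auto simp flip: m)
    also have "\<dots> = (\<integral>\<^sup>+x. \<integral>\<^sup>+u. g (m (frame_point w x u)) * q (coords (frame_point w x u) w) *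
        ennreal (p x) \<partial>lborel \<partial>lborel)"
      by (rule nn_integral_frame_swap) measurable
    also have "\<dots> = (\<integral>\<^sup>+x. \<integral>\<^sup>+u. q (u + coords x w) * (g (m x) * ennreal (p x)) \<partial>lborel \<partial>lborel)"
      by (simp add: m_frame_point coords_frame_point[OF w] mult_ac add.commute)
    also have "\<dots> = (\<integral>\<^sup>+x. c * (g (m x) * ennreal (p x)) \<partial>lborel)"
      unfolding c_def
      by (subst nn_integral_multc) (auto simp: nn_integral_lborel_translate)
    finally show ?thesis .
  qed
  \<comment> \<open>With \<open>g\<close> equal to 1: as \<open>q\<close> is positive, the finite
    integral excludes infinite slice mass.\<close>
  have "(\<integral>\<^sup>+x. q (coords x w) * m x \<partial>lborel) = c"
    using transport[of "\<lambda>_. 1"] int by (simp add: nn_integral_cmult)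
  then have "AE x in lborel. q (coords x w) * m x \<noteq> \<infinity>"
    using q(1) by (intro nn_integral_PInf_AE) (auto simp: c_def)
  \<comment> \<open>With \<open>g\<close> the indicator of 0: the transported integrand carries a
    factor \<open>m x = 0\<close>, so \<open>p\<close> vanishes almost everywhere on slices of mass
    0.\<close>
  moreover have "(\<integral>\<^sup>+x. c * (indicator {0} (m x) * ennreal (p x)) \<partial>lborel) = 0"
    by (subst transport[symmetric]) (auto simp: indicator_def nn_integral_0_iff_AE)
  then have "AE x in lborel. c * (indicator {0} (m x) * ennreal (p x)) = 0"
    by (subst (asm) nn_integral_0_iff_AE) auto
  ultimately have "AE x in lborel. 0 < ennreal (p x) \<longrightarrow> regular_slice p w (theta x w)"
  proof eventually_elim
    case (elim x)
    have "q (coords x w) \<noteq> 0" "q (coords x w) \<noteq> \<infinity>"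
      using q(2)[of "coords x w"] q(3)[of "coords x w"] by auto
    with elim c show ?case
      by (auto simp: regular_slice_def indicator_def less_top zero_less_iff_neq_zero
          ennreal_mult_eq_top_iff simp flip: m_def split: if_splits)
  qed
  then show ?thesis
    by (subst AE_density) auto
qed

text \<open>The disintegration identity: the weight \<open>p x * p (frame_point w x u) / m x\<close>
  is symmetric in its two points because the normalisation is common to the whole slice.\<close>

lemma nn_integral_slice_law:
  fixes p :: "real ^ 'k \<Rightarrow> real" and w :: "real ^ 'k ^ 'l"
  assumes p [measurable]: "p \<in> borel_measurable borel"
    and int: "(\<integral>\<^sup>+x. ennreal (p x) \<partial>lborel) = 1" and w: "w \<in> frames"
    and [measurable]: "F \<in> borel_measurable borel"
  defines "\<pi> \<equiv> density lborel (\<lambda>x. ennreal (p x))"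
  shows "(\<integral>\<^sup>+x. \<integral>\<^sup>+u. F (frame_point w (theta x w) u) \<partial>slice_law p w (theta x w) \<partial>\<pi>) =
    (\<integral>\<^sup>+x. F x \<partial>\<pi>)"
proof -
  define m where "m x = slice_mass p w (theta x w)" for x
  have [measurable]: "m \<in> borel_measurable borel"
    unfolding m_def by measurable
  have m: "m x = (\<integral>\<^sup>+u. ennreal (p (frame_point w x u)) \<partial>lborel)" for x
    unfolding m_def by (rule slice_mass_theta) measurable
  have m_frame_point: "m (frame_point w x u) = m x" for x u
    by (simp add: m_def theta_frame_point[OF w])
  have reg: "AE x in \<pi>. regular_slice p w (theta x w)"
    unfolding \<pi>_def by (rule AE_regular_slice[OF p int w])
  have "(\<integral>\<^sup>+x. \<integral>\<^sup>+u. F (frame_point w (theta x w) u) \<partial>slice_law p w (theta x w) \<partial>\<pi>) =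
      (\<integral>\<^sup>+x. \<integral>\<^sup>+u. ennreal (p (frame_point w x u)) / m x * F (frame_point w x u) \<partial>lborel \<partial>\<pi>)"
    using reg
  proof (intro nn_integral_cong_AE, eventually_elim)
    case (elim x)
    have "(\<integral>\<^sup>+u. F (frame_point w (theta x w) u) \<partial>slice_law p w (theta x w)) =
       (\<integral>\<^sup>+u. ennreal (p (frame_point w (theta x w) u)) / m x * F (frame_point w (theta x w) u) \<partial>lborel)"
      using elim unfolding slice_law_def m_def[symmetric] by (simp add: nn_integral_density)
    also have "\<dots> = (\<integral>\<^sup>+u. ennreal (p (frame_point w x u)) / m x * F (frame_point w x u) \<partial>lborel)"
      using nn_integral_lborel_translate[of
          "\<lambda>u. ennreal (p (frame_point w x u)) / m x * F (frame_point w x u)" "- coords x w"]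
      by (simp add: frame_point_theta)
    finally show ?case .
  qed
  also have "\<dots> = (\<integral>\<^sup>+x. \<integral>\<^sup>+u. ennreal (p x) *
      (ennreal (p (frame_point w x u)) / m x * F (frame_point w x u)) \<partial>lborel \<partial>lborel)"
    unfolding \<pi>_def by (simp add: nn_integral_density nn_integral_cmult)
  \<comment> \<open>Start and end exchange roles; now only one factor \<open>p\<close> depends on
    \<open>u\<close>, and its integral is \<open>m x\<close>.\<close>
  also have "\<dots> = (\<integral>\<^sup>+x. \<integral>\<^sup>+u. ennreal (p (frame_point w x u)) *
      (ennreal (p x) / m (frame_point w x u) * F x) \<partial>lborel \<partial>lborel)"
    by (subst nn_integral_frame_swap[symmetric]) (simp_all add: m_frame_point)
  also have "\<dots> = (\<integral>\<^sup>+x. m x * (ennreal (p x) / m x * F x) \<partial>lborel)"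
    by (simp add: m_frame_point nn_integral_multc flip: m)
  \<comment> \<open>The quotient \<open>m x / m x\<close> need not be 1 on exceptional slices, so it
    is kept until the integral is taken against \<pi>, which does not charge them.\<close>
  also have "\<dots> = (\<integral>\<^sup>+x. ennreal (p x) * (m x / m x * F x) \<partial>lborel)"
    by (simp add: divide_ennreal_def mult_ac)
  also have "\<dots> = (\<integral>\<^sup>+x. m x / m x * F x \<partial>\<pi>)"
    unfolding \<pi>_def by (simp add: nn_integral_density)
  also have "\<dots> = (\<integral>\<^sup>+x. F x \<partial>\<pi>)"
    using reg
  proof (intro nn_integral_cong_AE, eventually_elim)
    case (elim x)
    then have "m x / m x = 1"
      by (auto simp: regular_slice_def m_def intro: ennreal_divide_self)
    then show ?case by simp
  qed
  finally show ?thesis .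
qed

subsection \<open>Comparison of the kernels\<close>

text \<open>\<open>f\<close> need not be measurable. The bound \<open>b\<close> makes the set of
  almost-everywhere lower bounds bounded above, as a probability measure is not null; the supremum
  is then itself such a bound, by intersecting the countably many events for
  \<open>1 / real (Suc n)\<close>.\<close>

lemma essinf_bounds:
  assumes "prob_space M" and f: "AE x in M. 0 \<le> f x \<and> f x \<le> b"
  shows "0 \<le> essinf M f" and "AE x in M. essinf M f \<le> f x"
proof -
  interpret prob_space M by fact
  let ?C = "{c. AE x in M. c \<le> f x}"
  have 0: "0 \<in> ?C" using f by auto
  have le_b: "c \<le> b" if "c \<in> ?C" for c
  proof -
    have "AE x in M. c \<le> f x" using that by simp
    with f have "AE x in M. c \<le> b" by eventually_elim auto
    then show ?thesis by simp
  qed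
  then have bdd: "bdd_above ?C" by (rule bdd_aboveI)
  show "0 \<le> essinf M f"
    unfolding essinf_def using 0 bdd by (rule cSup_upper)
  have "AE x in M. \<forall>n. essinf M f - 1 / real (Suc n) \<le> f x"
  proof (subst AE_all_countable, rule allI)
    fix n :: nat
    have "essinf M f - 1 / real (Suc n) < Sup ?C"
      by (simp add: essinf_def)
    then obtain c where c: "c \<in> ?C" "essinf M f - 1 / real (Suc n) < c"
      using less_cSup_iff[OF _ bdd] 0 by blast
    then have "AE x in M. c \<le> f x" by simp
    then show "AE x in M. essinf M f - 1 / real (Suc n) \<le> f x"
      by eventually_elim (use c(2) in linarith)
  qed
  then show "AE x in M. essinf M f \<le> f x"
  proof eventually_elim
    case (elim x)
    have "(\<lambda>n. essinf M f - 1 / real (Suc n)) \<longlonglongrightarrow> essinf M f - 0"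
      using LIMSEQ_inverse_real_of_nat by (intro tendsto_diff tendsto_const) (simp add: inverse_eq_divide)
    then show ?case
      using elim by (intro LIMSEQ_le_const2[of _ "essinf M f"]) auto
  qed
qed

text \<open>Absorbs a constant into the function, so that none has to be pulled out of an iterated
  integral over frames and points.\<close>

lemma (in invariant_kernel) kernel_energy_cmult:
  assumes f: "square_integrable \<rho> f"
  shows "kernel_energy \<rho> K (\<lambda>x. a * f x) (\<lambda>x. a * f x) = ennreal (a\<^sup>2) * kernel_energy \<rho> K f f"
proof -
  have af: "square_integrable \<rho> (\<lambda>x. a * f x)"
    using f by (auto simp: square_integrable_def power_mult_distrib)
  have "kernel_op K (\<lambda>x. a * f x) = (\<lambda>x. a * kernel_op K f x)"
    by (simp add: kernel_op_def fun_eq_iff)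
  then have "L2_inner \<rho> (\<lambda>x. a * f x) (kernel_op K (\<lambda>x. a * f x)) =
      (\<integral>x. a\<^sup>2 * (f x * kernel_op K f x) \<partial>\<rho>)"
    unfolding L2_inner_def by (intro Bochner_Integration.integral_cong) (auto simp: power2_eq_square)
  then have "dirichlet_form \<rho> (kernel_op K) (\<lambda>x. a * f x) = a\<^sup>2 * dirichlet_form \<rho> (kernel_op K) f"
    by (simp add: dirichlet_form_def L2_norm_power2 L2_inner_def power_mult_distrib right_diff_distrib)
  then show ?thesis
    unfolding kernel_energy_diag(1)[OF f] kernel_energy_diag(1)[OF af]
    using kernel_energy_diag(2)[OF f]
    by (simp add: ennreal_mult[symmetric] mult.left_commute)
qed

locale frame_density =
  fixes p :: "real ^ 'k \<Rightarrow> real" and \<pi> :: "(real ^ 'k) measure" and \<nu> :: "(real ^ 'k ^ 'l) measure"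
  assumes p [measurable]: "p \<in> borel_measurable borel"
    and \<pi>_eq: "\<pi> = density lborel (\<lambda>x. ennreal (p x))" and prob_space_\<pi>: "prob_space \<pi>"
    and sets_\<nu> [measurable_cong]: "sets \<nu> = sets (restrict_space borel frames)"
    and prob_space_\<nu>: "prob_space \<nu>"
begin

sublocale \<pi>: prob_space \<pi> by (rule prob_space_\<pi>)
sublocale \<nu>: prob_space \<nu> by (rule prob_space_\<nu>)
sublocale \<nu>\<pi>: pair_prob_space \<nu> \<pi> ..

lemma sets_\<pi> [measurable_cong]: "sets \<pi> = sets borel"
  by (simp add: \<pi>_eq)

lemma space_\<pi>: "space \<pi> = UNIV"
  by (simp add: \<pi>_eq)

lemma space_\<nu>: "space \<nu> = frames"
  using sets_eq_imp_space_eq[OF sets_\<nu>] by (simp add: space_restrict_space)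

lemma measurable_\<nu> [measurable]: "(\<lambda>w. w) \<in> \<nu> \<rightarrow>\<^sub>M borel"
  by (simp add: measurable_cong_sets[OF sets_\<nu> refl] measurable_restrict_space1)

lemma measurable_fst_\<nu> [measurable]: "fst \<in> \<nu> \<Otimes>\<^sub>M N \<rightarrow>\<^sub>M borel"
  by (rule measurable_compose[OF measurable_fst measurable_\<nu>])

lemma measurable_snd_\<nu> [measurable]: "snd \<in> N \<Otimes>\<^sub>M \<nu> \<rightarrow>\<^sub>M borel"
  by (rule measurable_compose[OF measurable_snd measurable_\<nu>])

lemma nn_integral_p: "(\<integral>\<^sup>+x. ennreal (p x) \<partial>lborel) = 1"
  using \<pi>.emeasure_space_1 by (simp add: \<pi>_eq emeasure_density)

lemma AE_regular: "w \<in> frames \<Longrightarrow> AE x in \<pi>. regular_slice p w (theta x w)"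
  unfolding \<pi>_eq by (rule AE_regular_slice[OF p nn_integral_p])

lemma AE_pair_regular: "AE (w, x) in \<nu> \<Otimes>\<^sub>M \<pi>. regular_slice p w (theta x w)"
proof (rule \<nu>\<pi>.AE_pair_measure)
  show "{z \<in> space (\<nu> \<Otimes>\<^sub>M \<pi>). case z of (w, x) \<Rightarrow> regular_slice p w (theta x w)} \<in> sets (\<nu> \<Otimes>\<^sub>M \<pi>)"
    unfolding regular_slice_def by measurable
  show "AE w in \<nu>. AE x in \<pi>. case (w, x) of (w, x) \<Rightarrow> regular_slice p w (theta x w)"
  proof (rule AE_I2)
    fix w assume "w \<in> space \<nu>"
    then show "AE x in \<pi>. case (w, x) of (w, x) \<Rightarrow> regular_slice p w (theta x w)"
      using AE_regular[of w] by (simp add: space_\<nu>)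
  qed
qed

lemma nn_integral_slice:
  assumes "w \<in> frames" "F \<in> borel_measurable borel"
  shows "(\<integral>\<^sup>+x. \<integral>\<^sup>+u. F (frame_point w (theta x w) u) \<partial>slice_law p w (theta x w) \<partial>\<pi>) =
    (\<integral>\<^sup>+x. F x \<partial>\<pi>)"
  unfolding \<pi>_eq by (rule nn_integral_slice_law[OF p nn_integral_p assms])

text \<open>Stated on triples to match \<open>measurable_H\<close>, which it discharges for exact
  sampling.\<close>

lemma measurable_slice_law:
  "(\<lambda>(x, w, u). slice_law p w (theta x w)) \<in> borel \<Otimes>\<^sub>M \<nu> \<Otimes>\<^sub>M (borel :: (real ^ 'l) measure) \<rightarrow>\<^sub>M prob_algebra borel"
proof (intro measurable_prob_algebraI measurable_subprob_algebra)
  fix B :: "(real ^ 'l) set" assume [measurable]: "B \<in> sets borel"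
  have "emeasure (slice_law p w y) B =
      (if 0 < slice_mass p w y \<and> slice_mass p w y < \<infinity>
       then \<integral>\<^sup>+u. ennreal (p (frame_point w y u)) / slice_mass p w y * indicator B u \<partial>lborel
       else indicator B 0)" for w :: "real ^ 'k ^ 'l" and y
    by (simp add: slice_law_def regular_slice_def emeasure_density)
  moreover have [measurable]: "(\<lambda>z. fst (snd z)) \<in> borel \<Otimes>\<^sub>M \<nu> \<Otimes>\<^sub>M N \<rightarrow>\<^sub>M borel" for N :: "(real ^ 'l) measure"
    by (rule measurable_compose[OF measurable_snd measurable_fst_\<nu>])
  ultimately show "(\<lambda>z. emeasure (case z of (x, w, u) \<Rightarrow> slice_law p w (theta x w)) B)
      \<in> borel_measurable (borel \<Otimes>\<^sub>M \<nu> \<Otimes>\<^sub>M (borel :: (real ^ 'l) measure))"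
    by (simp add: split_beta') measurable
qed (auto simp: prob_space_slice_law intro: prob_space_imp_subprob_space)

lemma AE_square_integrable_slice:
  fixes w :: "real ^ 'k ^ 'l"
  assumes w: "w \<in> frames" and f: "square_integrable \<pi> f"
  shows "AE x in \<pi>. square_integrable (slice_law p w (theta x w))
    (\<lambda>u. f (frame_point w (theta x w) u))"
proof -
  have [measurable]: "f \<in> borel_measurable borel"
    using f by (simp add: square_integrable_def sets_\<pi> cong: measurable_cong_sets)
  have "(\<lambda>x. slice_law p w (theta x w)) \<in> borel \<rightarrow>\<^sub>M prob_algebra borel"
    using measurable_compose[OF _ measurable_slice_law, of "\<lambda>x. (x, w, 0)" borel] w
    by (simp add: space_\<nu>)
  then have [measurable]: "(\<lambda>x. slice_law p w (theta x w)) \<in> borel \<rightarrow>\<^sub>M subprob_algebra borel"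
    by (rule measurable_prob_algebraD)
  have "(\<integral>\<^sup>+x. \<integral>\<^sup>+u. ennreal ((f (frame_point w (theta x w) u))\<^sup>2)
      \<partial>slice_law p w (theta x w) \<partial>\<pi>) \<noteq> \<infinity>"
    using f by (subst nn_integral_slice[OF w]) (auto simp: square_integrable_iff_nn_integral)
  moreover have "(\<lambda>x. \<integral>\<^sup>+u. ennreal ((f (frame_point w (theta x w) u))\<^sup>2)
      \<partial>slice_law p w (theta x w)) \<in> borel_measurable borel"
    by (rule nn_integral_measurable_subprob_algebra2) measurable
  ultimately have "AE x in \<pi>. (\<integral>\<^sup>+u. ennreal ((f (frame_point w (theta x w) u))\<^sup>2)
      \<partial>slice_law p w (theta x w)) \<noteq> \<infinity>"
    by (intro nn_integral_PInf_AE) (auto cong: measurable_cong_sets simp: sets_\<pi>)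
  then show ?thesis
    by eventually_elim (auto simp: square_integrable_iff_nn_integral less_top)
qed

end

section \<open>The kernel S as a mixture of slice moves\<close>

locale frame_kernel = frame_density p \<pi> \<nu>
  for p :: "real ^ 'k \<Rightarrow> real" and \<pi> :: "(real ^ 'k) measure" and \<nu> :: "(real ^ 'k ^ 'l) measure" +
  fixes H :: "real ^ 'k ^ 'l \<Rightarrow> real ^ 'k \<Rightarrow> real ^ 'l \<Rightarrow> (real ^ 'l) measure"
  assumes measurable_H: "(\<lambda>(x, w, u). H w (theta x w) u) \<in> borel \<Otimes>\<^sub>M \<nu> \<Otimes>\<^sub>M borel \<rightarrow>\<^sub>M prob_algebra borel"
    and reversible_H: "\<And>x w. w \<in> frames \<Longrightarrow> regular_slice p w (theta x w) \<Longrightarrow>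
           reversible (slice_law p w (theta x w)) (H w (theta x w))"
begin

definition slice_step :: "real ^ 'k \<Rightarrow> real ^ 'k ^ 'l \<Rightarrow> (real ^ 'k) measure" where
  "slice_step x w = distr (H w (theta x w) (coords x w)) borel (frame_point w (theta x w))"

lemma measurable_slice_step:
  "(\<lambda>(x, w). slice_step x w) \<in> borel \<Otimes>\<^sub>M \<nu> \<rightarrow>\<^sub>M prob_algebra borel"
proof -
  have 1: "(\<lambda>(x, w). H w (theta x w) (coords x w)) \<in> borel \<Otimes>\<^sub>M \<nu> \<rightarrow>\<^sub>M prob_algebra borel"
    using measurable_compose[OF _ measurable_H, of "\<lambda>(x, w). (x, w, coords x w)" "borel \<Otimes>\<^sub>M \<nu>"]
    by (simp add: split_beta')
  have [measurable]: "(\<lambda>z. snd (fst z)) \<in> (borel \<Otimes>\<^sub>M \<nu>) \<Otimes>\<^sub>M N \<rightarrow>\<^sub>M borel" for N :: "(real ^ 'l) measure"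
    by (rule measurable_compose[OF measurable_fst measurable_snd_\<nu>])
  have 2: "(\<lambda>(z, u). frame_point (snd z) (theta (fst z) (snd z)) u)
      \<in> (borel \<Otimes>\<^sub>M \<nu>) \<Otimes>\<^sub>M borel \<rightarrow>\<^sub>M borel"
    unfolding split_beta' by measurable
  show ?thesis
    using measurable_distr_prob_space2[OF 1 2] by (simp add: slice_step_def split_beta')
qed

lemma S_kernel_eq: "S_kernel \<nu> H x = \<nu> \<bind> slice_step x"
  by (simp add: S_kernel_def slice_step_def[abs_def])

lemma slice_step_measurable1: "slice_step x \<in> \<nu> \<rightarrow>\<^sub>M prob_algebra borel"
  using measurable_Pair2[OF measurable_slice_step, of x] by simp

lemma slice_step_measurable2: "w \<in> frames \<Longrightarrow> (\<lambda>x. slice_step x w) \<in> borel \<rightarrow>\<^sub>M prob_algebra borel"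
  using measurable_Pair1[OF measurable_slice_step, of w] by (simp add: space_\<nu>)

lemma measurable_S_kernel: "S_kernel \<nu> H \<in> borel \<rightarrow>\<^sub>M prob_algebra borel"
proof -
  have "\<nu> \<in> space (prob_algebra \<nu>)"
    by (simp add: space_prob_algebra prob_space_\<nu>)
  then have "(\<lambda>x. \<nu> \<bind> slice_step x) \<in> borel \<rightarrow>\<^sub>M prob_algebra borel"
    using measurable_slice_step by (intro measurable_bind_prob_space2[where N=\<nu>]) auto
  then show ?thesis
    by (simp add: S_kernel_eq[abs_def])
qed

lemma prob_algebra_\<pi>: "prob_algebra \<pi> = prob_algebra borel"
  by (simp add: prob_algebra_def sets_\<pi> cong: subprob_algebra_cong)

lemma kernel_S: "S_kernel \<nu> H \<in> \<pi> \<rightarrow>\<^sub>M prob_algebra \<pi>"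
  using measurable_S_kernel by (simp add: prob_algebra_\<pi> sets_\<pi> cong: measurable_cong_sets)

lemma sets_H: "w \<in> frames \<Longrightarrow> sets (H w (theta x w) u) = sets borel"
  using measurable_space[OF measurable_H, of "(x, w, u)"]
  by (auto simp: space_pair_measure space_\<nu> space_prob_algebra)

lemma nn_integral_slice_step:
  assumes w: "w \<in> frames" and [measurable]: "h \<in> borel_measurable borel"
  shows "(\<integral>\<^sup>+y. h y \<partial>slice_step x w) =
    (\<integral>\<^sup>+u. h (frame_point w (theta x w) u) \<partial>H w (theta x w) (coords x w))"
proof -
  have "frame_point w (theta x w) \<in> borel \<rightarrow>\<^sub>M borel" by measurable
  then have "frame_point w (theta x w) \<in> H w (theta x w) (coords x w) \<rightarrow>\<^sub>M borel"
    by (simp add: sets_H[OF w] cong: measurable_cong_sets)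
  then show ?thesis
    unfolding slice_step_def by (subst nn_integral_distr) auto
qed

text \<open>The joint law of start and end of a stationary step: draw a frame, a slice, a start
  \<open>u\<close> from the slice law, and an end \<open>v\<close> from \<open>H\<close> at
  \<open>u\<close>. Nonnegativity of \<open>\<Phi>\<close> suffices for exchanging the
  integrals.\<close>

lemma nn_integral_S_kernel:
  fixes \<Phi> :: "real ^ 'k \<Rightarrow> real ^ 'k \<Rightarrow> ennreal"
  assumes \<Phi> [measurable]: "case_prod \<Phi> \<in> borel_measurable (borel \<Otimes>\<^sub>M borel)"
  shows "(\<integral>\<^sup>+x. \<integral>\<^sup>+y. \<Phi> x y \<partial>S_kernel \<nu> H x \<partial>\<pi>) =
    (\<integral>\<^sup>+w. \<integral>\<^sup>+x. \<integral>\<^sup>+u. \<integral>\<^sup>+v.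
        \<Phi> (frame_point w (theta x w) u) (frame_point w (theta x w) v)
      \<partial>H w (theta x w) u \<partial>slice_law p w (theta x w) \<partial>\<pi> \<partial>\<nu>)"
proof -
  interpret \<pi>\<nu>: pair_sigma_finite \<pi> \<nu> ..
  have "(\<integral>\<^sup>+x. \<integral>\<^sup>+y. \<Phi> x y \<partial>S_kernel \<nu> H x \<partial>\<pi>) =
      (\<integral>\<^sup>+x. \<integral>\<^sup>+w. \<integral>\<^sup>+y. \<Phi> x y \<partial>slice_step x w \<partial>\<nu> \<partial>\<pi>)"
    unfolding S_kernel_eq
    using measurable_prob_algebraD[OF slice_step_measurable1]
    by (intro nn_integral_cong nn_integral_bind[where B=borel]) auto
  also have "\<dots> = (\<integral>\<^sup>+w. \<integral>\<^sup>+x. \<integral>\<^sup>+y. \<Phi> x y \<partial>slice_step x w \<partial>\<pi> \<partial>\<nu>)"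
  proof (rule \<pi>\<nu>.Fubini'[symmetric])
    have "(\<lambda>z. \<integral>\<^sup>+y. \<Phi> (fst z) y \<partial>slice_step (fst z) (snd z)) \<in> borel_measurable (borel \<Otimes>\<^sub>M \<nu>)"
      using measurable_prob_algebraD[OF measurable_slice_step]
      by (intro nn_integral_measurable_subprob_algebra2[where N=borel]) (auto simp: split_beta')
    then show "(\<lambda>(x, w). \<integral>\<^sup>+y. \<Phi> x y \<partial>slice_step x w) \<in> borel_measurable (\<pi> \<Otimes>\<^sub>M \<nu>)"
      by (simp add: split_beta' sets_\<pi> cong: measurable_cong_sets sets_pair_measure_cong)
  qed
  also have "\<dots> = (\<integral>\<^sup>+w. \<integral>\<^sup>+x. \<integral>\<^sup>+u. \<integral>\<^sup>+v.
        \<Phi> (frame_point w (theta x w) u) (frame_point w (theta x w) v)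
      \<partial>H w (theta x w) u \<partial>slice_law p w (theta x w) \<partial>\<pi> \<partial>\<nu>)"
  proof (rule nn_integral_cong)
    fix w assume "w \<in> space \<nu>"
    then have w: "w \<in> frames" by (simp add: space_\<nu>)
    \<comment> \<open>As a function of the start alone, the integral over the end can be
      disintegrated by \<open>nn_integral_slice\<close>, which resamples the start within its
      slice.\<close>
    define F where "F x = (\<integral>\<^sup>+y. \<Phi> x y \<partial>slice_step x w)" for x
    have F: "F \<in> borel_measurable borel"
      unfolding F_def using measurable_prob_algebraD[OF slice_step_measurable2[OF w]]
      by (intro nn_integral_measurable_subprob_algebra2[where N=borel]) auto
    have "F (frame_point w (theta x w) u) =
        (\<integral>\<^sup>+v. \<Phi> (frame_point w (theta x w) u) (frame_point w (theta x w) v) \<partial>H w (theta x w) u)" for x u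
      unfolding F_def by (subst nn_integral_slice_step[OF w]) (auto simp: theta_theta[OF w] coords_theta[OF w])
    then show "(\<integral>\<^sup>+x. \<integral>\<^sup>+y. \<Phi> x y \<partial>slice_step x w \<partial>\<pi>) = (\<integral>\<^sup>+x. \<integral>\<^sup>+u. \<integral>\<^sup>+v.
        \<Phi> (frame_point w (theta x w) u) (frame_point w (theta x w) v)
      \<partial>H w (theta x w) u \<partial>slice_law p w (theta x w) \<partial>\<pi>)"
      using nn_integral_slice[OF w F] by (simp add: F_def)
  qed
  finally show ?thesis .
qed

lemma invariant_kernel_H:
  assumes "w \<in> frames" "regular_slice p w (theta x w)"
  shows "invariant_kernel (slice_law p w (theta x w)) (H w (theta x w))"
  using reversible_H[OF assms] prob_space_slice_law[OF p, of w "theta x w"]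
  by (simp add: invariant_kernel_def invariant_kernel_axioms_def reversible_def markov_kernel_def)

text \<open>Take an integrand that depends on the end only: invariance of the slice law removes the
  integral over \<open>H\<close>, and the disintegration reassembles \<pi>.\<close>

lemma invariant_S: "\<pi> \<bind> S_kernel \<nu> H = \<pi>"
proof (rule measure_eqI)
  have S: "S_kernel \<nu> H \<in> \<pi> \<rightarrow>\<^sub>M subprob_algebra \<pi>"
    using kernel_S by (rule measurable_prob_algebraD)
  show sets: "sets (\<pi> \<bind> S_kernel \<nu> H) = sets \<pi>"
    by (rule sets_bind[OF sets_kernel[OF S]]) (auto simp: space_\<pi>)
  fix A assume "A \<in> sets (\<pi> \<bind> S_kernel \<nu> H)"
  then have A: "A \<in> sets \<pi>" and [measurable]: "A \<in> sets borel" by (simp_all add: sets sets_\<pi>)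
  have "emeasure (\<pi> \<bind> S_kernel \<nu> H) A = (\<integral>\<^sup>+y. indicator A y \<partial>(\<pi> \<bind> S_kernel \<nu> H))"
    using A sets by simp
  also have "\<dots> = (\<integral>\<^sup>+x. \<integral>\<^sup>+y. indicator A y \<partial>S_kernel \<nu> H x \<partial>\<pi>)"
    by (rule nn_integral_bind[OF _ S]) (simp add: A)
  also have "\<dots> = (\<integral>\<^sup>+w. \<integral>\<^sup>+x. \<integral>\<^sup>+u. \<integral>\<^sup>+v. indicator A (frame_point w (theta x w) v)
      \<partial>H w (theta x w) u \<partial>slice_law p w (theta x w) \<partial>\<pi> \<partial>\<nu>)"
    by (rule nn_integral_S_kernel) measurable
  also have "\<dots> = (\<integral>\<^sup>+w. emeasure \<pi> A \<partial>\<nu>)"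
  proof (rule nn_integral_cong)
    fix w assume "w \<in> space \<nu>"
    then have w: "w \<in> frames" by (simp add: space_\<nu>)
    have "(\<integral>\<^sup>+x. \<integral>\<^sup>+u. \<integral>\<^sup>+v. indicator A (frame_point w (theta x w) v)
        \<partial>H w (theta x w) u \<partial>slice_law p w (theta x w) \<partial>\<pi>) =
        (\<integral>\<^sup>+x. \<integral>\<^sup>+u. indicator A (frame_point w (theta x w) u) \<partial>slice_law p w (theta x w) \<partial>\<pi>)"
      using AE_regular[OF w]
    proof (intro nn_integral_cong_AE, eventually_elim)
      case (elim x)
      show ?case
        by (rule invariant_kernel.nn_integral_kernel[OF invariant_kernel_H[OF w elim(2)]]) measurable
    qed
    also have "\<dots> = emeasure \<pi> A"
      using nn_integral_slice[OF w, of "indicator A"] A by simp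
    finally show "(\<integral>\<^sup>+x. \<integral>\<^sup>+u. \<integral>\<^sup>+v. indicator A (frame_point w (theta x w) v)
        \<partial>H w (theta x w) u \<partial>slice_law p w (theta x w) \<partial>\<pi>) = emeasure \<pi> A" .
  qed
  finally show "emeasure (\<pi> \<bind> S_kernel \<nu> H) A = emeasure \<pi> A"
    by (simp add: \<nu>.emeasure_space_1)
qed

sublocale S: invariant_kernel \<pi> "S_kernel \<nu> H"
  by unfold_locales (rule kernel_S, rule invariant_S)

lemma kernel_energy_S:
  assumes f: "square_integrable \<pi> f" and g: "square_integrable \<pi> g"
  shows "kernel_energy \<pi> (S_kernel \<nu> H) f g =
    (\<integral>\<^sup>+w. \<integral>\<^sup>+x. kernel_energy (slice_law p w (theta x w)) (H w (theta x w))
      (\<lambda>u. f (frame_point w (theta x w) u)) (\<lambda>u. g (frame_point w (theta x w) u)) \<partial>\<pi> \<partial>\<nu>)"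
proof -
  have [measurable]: "f \<in> borel_measurable borel" "g \<in> borel_measurable borel"
    using f g by (simp_all add: square_integrable_def sets_\<pi> cong: measurable_cong_sets)
  show ?thesis
    unfolding kernel_energy_def by (rule nn_integral_S_kernel) measurable
qed

lemma reversible_S: "reversible \<pi> (S_kernel \<nu> H)"
proof (rule S.reversibleI)
  fix f g assume f: "square_integrable \<pi> f" and g: "square_integrable \<pi> g"
  show "kernel_energy \<pi> (S_kernel \<nu> H) f g = kernel_energy \<pi> (S_kernel \<nu> H) g f"
    unfolding kernel_energy_S[OF f g] kernel_energy_S[OF g f]
  proof (rule nn_integral_cong, rule nn_integral_cong_AE)
    fix w assume "w \<in> space \<nu>"
    then have w: "w \<in> frames" by (simp add: space_\<nu>)
    show "AE x in \<pi>. kernel_energy (slice_law p w (theta x w)) (H w (theta x w))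
        (\<lambda>u. f (frame_point w (theta x w) u)) (\<lambda>u. g (frame_point w (theta x w) u)) =
      kernel_energy (slice_law p w (theta x w)) (H w (theta x w))
        (\<lambda>u. g (frame_point w (theta x w) u)) (\<lambda>u. f (frame_point w (theta x w) u))"
      \<comment> \<open>Symmetry holds slice by slice, where the restrictions of \<open>f\<close>
        and \<open>g\<close> are almost surely square integrable.\<close>
      using AE_regular[OF w] AE_square_integrable_slice[OF w f] AE_square_integrable_slice[OF w g]
    proof eventually_elim
      case (elim x)
      show ?case
        using reversible_H[OF w elim(1)] elim(2,3)
        by (intro invariant_kernel.kernel_energy_commute[OF invariant_kernel_H[OF w elim(1)]])
          (auto simp: reversible_def)
    qed
  qed
qed

end

sublocale frame_density \<subseteq> Sbar: frame_kernel p \<pi> \<nu> "\<lambda>w y u. slice_law p w y"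
  by unfold_locales
    (use measurable_slice_law in simp, rule prob_space.reversible_const[OF prob_space_slice_law[OF p]])

lemma Sbar_kernel_eq: "Sbar_kernel \<nu> p = S_kernel \<nu> (\<lambda>w y u. slice_law p w y)"
  by (simp add: fun_eq_iff Sbar_kernel_def S_kernel_def)

section \<open>Slice gaps and the comparison of S with Sbar\<close>

context frame_kernel
begin

definition slice_gap :: "real ^ 'k ^ 'l \<Rightarrow> real ^ 'k \<Rightarrow> real" where
  "slice_gap w x = gap (slice_law p w (theta x w)) (kernel_op (H w (theta x w)))"

text \<open>Regularity gives the slice law a Lebesgue density, hence a nonzero mean-zero function.
  For the point mass on an exceptional slice the infimum would be over the empty set.\<close>

lemma slice_gap_bounds:
  assumes "w \<in> frames" "regular_slice p w (theta x w)"
  shows "0 \<le> slice_gap w x \<and> slice_gap w x \<le> 2"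
proof -
  interpret K: invariant_kernel "slice_law p w (theta x w)" "H w (theta x w)"
    by (rule invariant_kernel_H[OF assms])
  have "\<exists>f \<in> L2_zero (slice_law p w (theta x w)). \<not> (AE u in slice_law p w (theta x w). f u = 0)"
    using K.prob_space_axioms assms(2) unfolding slice_law_def
    by (simp only: if_True) (rule exists_nonzero_L2_zero, measurable)
  then show ?thesis
    using K.gap_nonneg K.gap_le_2 by (auto simp: slice_gap_def)
qed

lemma AE_slice_gap_bounds: "AE (w, x) in \<nu> \<Otimes>\<^sub>M \<pi>. 0 \<le> slice_gap w x \<and> slice_gap w x \<le> 2"
  using AE_pair_regular AE_space
  by eventually_elim (auto simp: space_pair_measure space_\<nu> dest!: slice_gap_bounds)

definition slice_gap_inf :: real where
  "slice_gap_inf = essinf (\<nu> \<Otimes>\<^sub>M \<pi>) (\<lambda>(w, x). slice_gap w x)"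

lemma slice_gap_inf_bounds:
  "0 \<le> slice_gap_inf" "AE w in \<nu>. AE x in \<pi>. slice_gap_inf \<le> slice_gap w x"
proof -
  have *: "AE z in \<nu> \<Otimes>\<^sub>M \<pi>. 0 \<le> (case z of (w, x) \<Rightarrow> slice_gap w x) \<and> (case z of (w, x) \<Rightarrow> slice_gap w x) \<le> 2"
    using AE_slice_gap_bounds by (simp add: split_beta')
  show "0 \<le> slice_gap_inf"
    unfolding slice_gap_inf_def by (rule essinf_bounds(1)[OF \<nu>\<pi>.P.prob_space_axioms *])
  show "AE w in \<nu>. AE x in \<pi>. slice_gap_inf \<le> slice_gap w x"
    using \<nu>\<pi>.AE_pair[OF essinf_bounds(2)[OF \<nu>\<pi>.P.prob_space_axioms *]]
    by (simp add: slice_gap_inf_def)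
qed

lemma kernel_energy_S_ge:
  assumes f: "square_integrable \<pi> f"
  shows "ennreal slice_gap_inf * kernel_energy \<pi> (Sbar_kernel \<nu> p) f f \<le> kernel_energy \<pi> (S_kernel \<nu> H) f f"
proof -
  \<comment> \<open>The square root moves the essential infimum inside the energy as a factor of
    \<open>f\<close>, ready for a pointwise comparison under the integrals.\<close>
  define r where "r = sqrt slice_gap_inf"
  have r: "r\<^sup>2 = slice_gap_inf" using slice_gap_inf_bounds(1) by (simp add: r_def)
  have rf: "square_integrable \<pi> (\<lambda>x. r * f x)"
    using f by (auto simp: square_integrable_def power_mult_distrib)
  have "ennreal slice_gap_inf * kernel_energy \<pi> (Sbar_kernel \<nu> p) f f =
      kernel_energy \<pi> (Sbar_kernel \<nu> p) (\<lambda>x. r * f x) (\<lambda>x. r * f x)"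
    unfolding Sbar_kernel_eq Sbar.S.kernel_energy_cmult[OF f] r ..
  also have "\<dots> \<le> kernel_energy \<pi> (S_kernel \<nu> H) f f"
    unfolding Sbar_kernel_eq Sbar.kernel_energy_S[OF rf rf] kernel_energy_S[OF f f]
  proof (rule nn_integral_mono_AE)
    show "AE w in \<nu>. (\<integral>\<^sup>+x. kernel_energy (slice_law p w (theta x w)) (\<lambda>u. slice_law p w (theta x w))
        (\<lambda>u. r * f (frame_point w (theta x w) u)) (\<lambda>u. r * f (frame_point w (theta x w) u)) \<partial>\<pi>)
      \<le> (\<integral>\<^sup>+x. kernel_energy (slice_law p w (theta x w)) (H w (theta x w))
        (\<lambda>u. f (frame_point w (theta x w) u)) (\<lambda>u. f (frame_point w (theta x w) u)) \<partial>\<pi>)"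
      using slice_gap_inf_bounds(2) AE_space
    proof (eventually_elim, intro nn_integral_mono_AE)
      fix w assume gap: "AE x in \<pi>. slice_gap_inf \<le> slice_gap w x" and "w \<in> space \<nu>"
      then have w: "w \<in> frames" by (simp add: space_\<nu>)
      show "AE x in \<pi>. kernel_energy (slice_law p w (theta x w)) (\<lambda>u. slice_law p w (theta x w))
          (\<lambda>u. r * f (frame_point w (theta x w) u)) (\<lambda>u. r * f (frame_point w (theta x w) u))
        \<le> kernel_energy (slice_law p w (theta x w)) (H w (theta x w))
          (\<lambda>u. f (frame_point w (theta x w) u)) (\<lambda>u. f (frame_point w (theta x w) u))"
        using gap AE_regular[OF w] AE_square_integrable_slice[OF w f]
      proof eventually_elim
        case (elim x)
        interpret K: invariant_kernel "slice_law p w (theta x w)" "H w (theta x w)"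
          by (rule invariant_kernel_H[OF w elim(2)])
        show ?case
          unfolding invariant_kernel.kernel_energy_cmult[OF K.invariant_kernel_const elim(3)] r
          using slice_gap_inf_bounds(1) elim(1)
          by (intro K.gap_mult_kernel_energy_const_le elim(3)) (simp_all add: slice_gap_def)
      qed
    qed
  qed
  finally show ?thesis .
qed

lemma dirichlet_form_S_ge:
  assumes f: "square_integrable \<pi> f"
  shows "slice_gap_inf * dirichlet_form \<pi> (kernel_op (Sbar_kernel \<nu> p)) f
    \<le> dirichlet_form \<pi> (kernel_op (S_kernel \<nu> H)) f"
proof -
  have "ennreal (slice_gap_inf * (2 * dirichlet_form \<pi> (kernel_op (Sbar_kernel \<nu> p)) f)) \<le>
      ennreal (2 * dirichlet_form \<pi> (kernel_op (S_kernel \<nu> H)) f)"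
    using kernel_energy_S_ge[OF f] slice_gap_inf_bounds(1) Sbar.S.kernel_energy_diag(2)[OF f]
    unfolding Sbar_kernel_eq S.kernel_energy_diag(1)[OF f] Sbar.S.kernel_energy_diag(1)[OF f]
    by (subst ennreal_mult) auto
  then show ?thesis
    using S.kernel_energy_diag(2)[OF f] by (subst (asm) ennreal_le_iff) auto
qed

text \<open>Each quotient for \<open>S\<close> dominates the scaled quotient for
  \<open>Sbar\<close>; a nonzero element of \<open>L2_zero\<close> lets this pass to the infimum for
  \<open>S\<close>.\<close>

lemma gap_S_ge:
  "slice_gap_inf * gap \<pi> (kernel_op (Sbar_kernel \<nu> p)) \<le> gap \<pi> (kernel_op (S_kernel \<nu> H))"
proof -
  have ne: "\<exists>f \<in> L2_zero \<pi>. \<not> (AE x in \<pi>. f x = 0)"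
    using prob_space_\<pi> unfolding \<pi>_eq by (rule exists_nonzero_L2_zero[rotated]) measurable
  have "slice_gap_inf * gap \<pi> (kernel_op (Sbar_kernel \<nu> p)) \<le>
      dirichlet_form \<pi> (kernel_op (S_kernel \<nu> H)) f / (L2_norm \<pi> f)\<^sup>2"
    if f: "f \<in> L2_zero \<pi>" "\<not> (AE x in \<pi>. f x = 0)" for f
  proof -
    have "slice_gap_inf * gap \<pi> (kernel_op (Sbar_kernel \<nu> p)) \<le>
        slice_gap_inf * (dirichlet_form \<pi> (kernel_op (Sbar_kernel \<nu> p)) f / (L2_norm \<pi> f)\<^sup>2)"
      using Sbar.S.gap_le_quotient[OF f] slice_gap_inf_bounds(1)
      by (intro mult_left_mono) (simp_all add: Sbar_kernel_eq)
    also have "\<dots> \<le> dirichlet_form \<pi> (kernel_op (S_kernel \<nu> H)) f / (L2_norm \<pi> f)\<^sup>2"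
      using dirichlet_form_S_ge f by (simp add: L2_zero_iff divide_right_mono)
    finally show ?thesis .
  qed
  then show ?thesis
    using ne unfolding gap_def[of _ "kernel_op (S_kernel \<nu> H)"]
    by (intro cINF_greatest) auto
qed

end

theorem proposition6:
  fixes p :: "real ^ 'k \<Rightarrow> real"
    and \<pi> :: "(real ^ 'k) measure"
    and \<nu> :: "(real ^ 'k ^ 'l) measure"
    and H :: "real ^ 'k ^ 'l \<Rightarrow> real ^ 'k \<Rightarrow> real ^ 'l \<Rightarrow> (real ^ 'l) measure"
  defines "G \<equiv> essinf (\<nu> \<Otimes>\<^sub>M \<pi>)
      (\<lambda>(w, x). gap (slice_law p w (theta x w)) (kernel_op (H w (theta x w))))"
  assumes "CARD('l) \<le> CARD('k)"
    and "p \<in> borel_measurable borel" and "\<And>x. 0 \<le> p x"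
    and "\<pi> = density lborel (\<lambda>x. ennreal (p x))" and "prob_space \<pi>"
    and "sets \<nu> = sets (restrict_space borel frames)" and "prob_space \<nu>"
    and "\<And>x w. w \<in> frames \<Longrightarrow> markov_kernel borel (H w (theta x w))"
    and "\<And>x w. w \<in> frames \<Longrightarrow> regular_slice p w (theta x w) \<Longrightarrow>
           reversible (slice_law p w (theta x w)) (H w (theta x w))"
    and "\<And>B. B \<in> sets borel \<Longrightarrow>
           (\<lambda>(x, w, u). emeasure (H w (theta x w) u) B)
             \<in> borel_measurable (borel \<Otimes>\<^sub>M restrict_space borel frames \<Otimes>\<^sub>M borel)"
  shows "reversible \<pi> (S_kernel \<nu> H) \<and> reversible \<pi> (Sbar_kernel \<nu> p) \<and>
    (\<forall>f\<in>L2_zero \<pi>. dirichlet_form \<pi> (kernel_op (S_kernel \<nu> H)) f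
        \<ge> G * dirichlet_form \<pi> (kernel_op (Sbar_kernel \<nu> p)) f) \<and>
    gap \<pi> (kernel_op (S_kernel \<nu> H)) \<ge> G * gap \<pi> (kernel_op (Sbar_kernel \<nu> p))"
proof -
  have density: "frame_density p \<pi> \<nu>"
    using assms by (simp add: frame_density_def)
  have space: "space \<nu> = frames"
    using frame_density.space_\<nu>[OF density] .
  \<comment> \<open>Joint measurability as a map into probability measures is checked on Borel sets,
    by the measurability hypothesis; the Markov hypothesis covers exceptional slices too.\<close>
  have "(\<lambda>(x, w, u). H w (theta x w) u) \<in> borel \<Otimes>\<^sub>M \<nu> \<Otimes>\<^sub>M borel \<rightarrow>\<^sub>M prob_algebra borel"
  proof (intro measurable_prob_algebraI measurable_subprob_algebra)
    fix z :: "(real ^ 'k) \<times> (real ^ 'k ^ 'l) \<times> (real ^ 'l)"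
    assume z: "z \<in> space (borel \<Otimes>\<^sub>M \<nu> \<Otimes>\<^sub>M borel)"
    obtain x w u where [simp]: "z = (x, w, u)" by (cases z)
    have "H w (theta x w) \<in> borel \<rightarrow>\<^sub>M prob_algebra borel"
      using z assms(9) by (auto simp: space_pair_measure space markov_kernel_def)
    from measurable_space[OF this, of u]
    show "prob_space (case z of (x, w, u) \<Rightarrow> H w (theta x w) u)"
      "subprob_space (case z of (x, w, u) \<Rightarrow> H w (theta x w) u)"
      "sets (case z of (x, w, u) \<Rightarrow> H w (theta x w) u) = sets borel"
      by (auto simp: space_prob_algebra prob_space_imp_subprob_space)
  next
    fix B :: "(real ^ 'l) set" assume B: "B \<in> sets borel"
    have "sets (borel \<Otimes>\<^sub>M \<nu> \<Otimes>\<^sub>M borel :: ((real ^ 'k) \<times> (real ^ 'k ^ 'l) \<times> (real ^ 'l)) measure) =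
        sets (borel \<Otimes>\<^sub>M restrict_space borel frames \<Otimes>\<^sub>M borel)"
      using assms(7) by (intro sets_pair_measure_cong refl)
    then show "(\<lambda>z. emeasure (case z of (x, w, u) \<Rightarrow> H w (theta x w) u) B)
        \<in> borel_measurable (borel \<Otimes>\<^sub>M \<nu> \<Otimes>\<^sub>M borel)"
      using assms(11)[OF B] by (simp add: split_beta' cong: measurable_cong_sets)
  qed
  then interpret frame_kernel p \<pi> \<nu> H
    using density assms(10) by (simp add: frame_kernel_def frame_kernel_axioms_def)
  have "G = slice_gap_inf"
    by (simp add: G_def slice_gap_inf_def slice_gap_def)
  then show ?thesis
    using reversible_S Sbar.reversible_S dirichlet_form_S_ge gap_S_ge
    by (simp add: Sbar_kernel_eq L2_zero_iff)
qed

end
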